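(* The category $\mathbf{HI\text{-}TopSys}$ is equivalent to the category $\mathbf{ESA}$.
   Context: An ordered topological space $(X,\leq,\tau)$ (with $\le$ a partial order) is an Esakia space if $(X,\tau)$ is compact; for any $x,y\in X$ with $x\nleq y$ there exists a clopen up-set $U\subseteq X$ with $x\in U$, $y\notin U$; and for any clopen set $U$ the down-set $\downarrow U$ is also clopen. An Esakia morphism between Esakia spaces is a continuous bounded morphism (p-morphism) $f:X\to Y$, i.e. a continuous order-preserving map such that for each $x\in X$, $y\in Y$, if $f(x)\le y$ then there exists $z\in X$ with $x\le z$ and $f(z)=y$. $\mathbf{ESA}$ is the category of Esakia spaces and Esakia morphisms. A Heyting algebra is an algebra $(A,\vee,\wedge,\rightarrow,\mathbf{1},\mathbf{0})$ such that $(A,\vee,\wedge,\mathbf{1},\mathbf{0})$ is a bounded distributive lattice and $\rightarrow$ is a binary operation adjoint to $\wedge$ ($c\wedge a\le b$ iff $c\le a\rightarrow b$). A Heyting homomorphism is a map preserving $\wedge,\vee,\rightarrow,\mathbf{0}$. $Hom(A,\{0,1\})$ denotes the set of all bounded distributive lattice homomorphisms from $A$ to the two-element algebra $\{0,1\}$, ordered pointwise: $h_1Rh_2$ iff $h_1(a)\le h_2(a)$ for all $a\in A$. An I-topological system is a triple $(X,\models,A)$ consisting of a nonempty set $X$, a Heyting algebra $A$ and a relation $\models$ from $X$ to $A$ such that: (1) $x\models\mathbf{0}$ for no $x\in X$; (2) $x\models a\wedge b$ iff $x\models a$ and $x\models b$; (3) $x\models a\vee b$ iff $x\models a$ or $x\models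 b$; (4) $x\models a\rightarrow b$ iff for all $y\in X$ such that $p^*(x)Rp^*(y)$, $y\not\models a$ or $y\models b$, where $p^*:X\to Hom(A,\{0,1\})$ is given by $p^*(x)(a)=1$ iff $x\models a$. It is Heyting algebraic if $p^*$ is a bijection. $\mathbf{HI\text{-}TopSys}$ is the category whose objects are Heyting algebraic I-topological systems and whose morphisms $(X,\models,A)\to(Y,\models',B)$ are pairs $(f_1,f_2)$ with $f_1:X\to Y$ a map of sets, $f_2:B\to A$ a Heyting homomorphism, and $x\models f_2(b)$ iff $f_1(x)\models' b$ for all $x\in X$, $b\in B$. Identities are $(id_X,id_A)$ and composition is $(g_1,g_2)\circ(f_1,f_2)=(g_1\circ f_1,f_2\circ g_2)$.
   Formalization: Esakia spaces are required to be nonempty: the empty space satisfies the stated definition and would be an initial object of ESA, while HI-TopSys, whose systems have nonempty point sets, has no initial object. *)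

theory Defs
  imports "HOL-Analysis.Abstract_Topology"
begin

section \<open>Categories, functors, equivalence\<close>

text \<open>
  Hom-sets are indexed by pairs of objects and need not be disjoint, so composition takes the
  three objects involved as arguments: \<open>comp C a b c g f\<close> is the composite of
  \<open>f : a \<rightarrow> b\<close> and \<open>g : b \<rightarrow> c\<close>.
\<close>

record ('o, 'm) cat =
  obj :: "'o set"
  hom :: "'o \<Rightarrow> 'o \<Rightarrow> 'm set"
  ide :: "'o \<Rightarrow> 'm"
  comp :: "'o \<Rightarrow> 'o \<Rightarrow> 'o \<Rightarrow> 'm \<Rightarrow> 'm \<Rightarrow> 'm"

locale category =
  fixes C :: "('o, 'm) cat"
  assumes ide_in_hom: "a \<in> obj C \<Longrightarrow> ide C a \<in> hom C a a"
    and comp_in_hom: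
      "\<lbrakk>a \<in> obj C; b \<in> obj C; c \<in> obj C; f \<in> hom C a b; g \<in> hom C b c\<rbrakk>
        \<Longrightarrow> comp C a b c g f \<in> hom C a c"
    and comp_ide_right:
      "\<lbrakk>a \<in> obj C; b \<in> obj C; f \<in> hom C a b\<rbrakk> \<Longrightarrow> comp C a a b f (ide C a) = f"
    and comp_ide_left:
      "\<lbrakk>a \<in> obj C; b \<in> obj C; f \<in> hom C a b\<rbrakk> \<Longrightarrow> comp C a b b (ide C b) f = f"
    and comp_assoc:
      "\<lbrakk>a \<in> obj C; b \<in> obj C; c \<in> obj C; d \<in> obj C;
        f \<in> hom C a b; g \<in> hom C b c; h \<in> hom C c d\<rbrakk>
        \<Longrightarrow> comp C a c d h (comp C a b c g f) = comp C a b d (comp C b c d h g) f"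

record ('o1, 'm1, 'o2, 'm2) func =
  on_obj :: "'o1 \<Rightarrow> 'o2"
  on_hom :: "'o1 \<Rightarrow> 'o1 \<Rightarrow> 'm1 \<Rightarrow> 'm2"

locale cat_functor =
  fixes C :: "('o1, 'm1) cat" and D :: "('o2, 'm2) cat" and F :: "('o1, 'm1, 'o2, 'm2) func"
  assumes on_obj_closed: "a \<in> obj C \<Longrightarrow> on_obj F a \<in> obj D"
    and on_hom_closed:
      "\<lbrakk>a \<in> obj C; b \<in> obj C; f \<in> hom C a b\<rbrakk>
        \<Longrightarrow> on_hom F a b f \<in> hom D (on_obj F a) (on_obj F b)"
    and on_hom_ide: "a \<in> obj C \<Longrightarrow> on_hom F a a (ide C a) = ide D (on_obj F a)"
    and on_hom_comp:
      "\<lbrakk>a \<in> obj C; b \<in> obj C; c \<in> obj C; f \<in> hom C a b; g \<in> hom C b c\<rbrakk>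
        \<Longrightarrow> on_hom F a c (comp C a b c g f) =
            comp D (on_obj F a) (on_obj F b) (on_obj F c) (on_hom F b c g) (on_hom F a b f)"

definition id_func :: "('o, 'm, 'o, 'm) func" where
  "id_func = \<lparr>on_obj = (\<lambda>a. a), on_hom = (\<lambda>a b f. f)\<rparr>"

definition comp_func ::
  "('o2, 'm2, 'o3, 'm3) func \<Rightarrow> ('o1, 'm1, 'o2, 'm2) func \<Rightarrow> ('o1, 'm1, 'o3, 'm3) func" where
  "comp_func G F =
    \<lparr>on_obj = (\<lambda>a. on_obj G (on_obj F a)),
     on_hom = (\<lambda>a b f. on_hom G (on_obj F a) (on_obj F b) (on_hom F a b f))\<rparr>"

definition iso_in :: "('o, 'm) cat \<Rightarrow> 'o \<Rightarrow> 'o \<Rightarrow> 'm \<Rightarrow> bool" where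
  "iso_in C a b f \<longleftrightarrow>
    f \<in> hom C a b \<and>
    (\<exists>g \<in> hom C b a. comp C a b a g f = ide C a \<and> comp C b a b f g = ide C b)"

locale natural_isomorphism =
  fixes C :: "('o1, 'm1) cat" and D :: "('o2, 'm2) cat"
    and F G :: "('o1, 'm1, 'o2, 'm2) func" and \<eta> :: "'o1 \<Rightarrow> 'm2"
  assumes component_iso: "a \<in> obj C \<Longrightarrow> iso_in D (on_obj F a) (on_obj G a) (\<eta> a)"
    and naturality:
      "\<lbrakk>a \<in> obj C; b \<in> obj C; f \<in> hom C a b\<rbrakk>
        \<Longrightarrow> comp D (on_obj F a) (on_obj F b) (on_obj G b) (\<eta> b) (on_hom F a b f) =
            comp D (on_obj F a) (on_obj G a) (on_obj G b) (on_hom G a b f) (\<eta> a)"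

definition equivalent_categories :: "('o1, 'm1) cat \<Rightarrow> ('o2, 'm2) cat \<Rightarrow> bool" where
  "equivalent_categories C D \<longleftrightarrow>
    category C \<and> category D \<and>
    (\<exists>F G. cat_functor C D F \<and> cat_functor D C G \<and>
      (\<exists>\<eta>. natural_isomorphism C C id_func (comp_func G F) \<eta>) \<and>
      (\<exists>\<epsilon>. natural_isomorphism D D (comp_func F G) id_func \<epsilon>))"


section \<open>Esakia spaces\<close>

record 'x ordered_space =
  topo :: "'x topology"
  ord :: "('x \<times> 'x) set"

definition clopenin :: "'x topology \<Rightarrow> 'x set \<Rightarrow> bool" where
  "clopenin T U \<longleftrightarrow> openin T U \<and> closedin T U"

definition up_set :: "'x ordered_space \<Rightarrow> 'x set \<Rightarrow> bool" where
  "up_set E U \<longleftrightarrow>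
    U \<subseteq> topspace (topo E) \<and> (\<forall>x y. x \<in> U \<and> (x, y) \<in> ord E \<longrightarrow> y \<in> U)"

definition down_closure :: "'x ordered_space \<Rightarrow> 'x set \<Rightarrow> 'x set" where
  "down_closure E U = {x \<in> topspace (topo E). \<exists>y\<in>U. (x, y) \<in> ord E}"

text \<open>
  Spaces are nonempty by convention. This matches the nonemptiness demanded of the set of points
  of an I-topological system.
\<close>

locale esakia_space =
  fixes E :: "'x ordered_space"
  assumes nonempty: "topspace (topo E) \<noteq> {}"
    and partial_order: "partial_order_on (topspace (topo E)) (ord E)"
    and compact: "compact_space (topo E)"
    and separation:
      "\<lbrakk>x \<in> topspace (topo E); y \<in> topspace (topo E); (x, y) \<notin> ord E\<rbrakk>
        \<Longrightarrow> \<exists>U. clopenin (topo E) U \<and> up_set E U \<and> x \<in> U \<and> y \<notin> U"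
    and clopen_down: "clopenin (topo E) U \<Longrightarrow> clopenin (topo E) (down_closure E U)"

text \<open>
  Maps between carriers are extensional functions (\<open>\<rightarrow>\<^sub>E\<close>), so that equality
  of morphisms is equality on the carrier of the domain.
\<close>

definition esakia_morphism :: "'x ordered_space \<Rightarrow> 'y ordered_space \<Rightarrow> ('x \<Rightarrow> 'y) \<Rightarrow> bool" where
  "esakia_morphism E E' f \<longleftrightarrow>
    f \<in> topspace (topo E) \<rightarrow>\<^sub>E topspace (topo E') \<and>
    continuous_map (topo E) (topo E') f \<and>
    (\<forall>x y. (x, y) \<in> ord E \<longrightarrow> (f x, f y) \<in> ord E') \<and>
    (\<forall>x \<in> topspace (topo E). \<forall>y \<in> topspace (topo E').
      (f x, y) \<in> ord E' \<longrightarrow> (\<exists>z \<in> topspace (topo E). (x, z) \<in> ord E \<and> f z = y))"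

definition ESA :: "('x ordered_space, 'x \<Rightarrow> 'x) cat" where
  "ESA =
    \<lparr>obj = {E. esakia_space E},
     hom = (\<lambda>E E'. {f. esakia_morphism E E' f}),
     ide = (\<lambda>E. \<lambda>x\<in>topspace (topo E). x),
     comp = (\<lambda>E E' E'' g f. compose (topspace (topo E)) g f)\<rparr>"


section \<open>Heyting algebras\<close>

record 'a heyting =
  carr :: "'a set"
  join :: "'a \<Rightarrow> 'a \<Rightarrow> 'a"  (infixl "\<squnion>\<index>" 65)
  meet :: "'a \<Rightarrow> 'a \<Rightarrow> 'a"  (infixl "\<sqinter>\<index>" 70)
  himp :: "'a \<Rightarrow> 'a \<Rightarrow> 'a"  (infixr "\<leadsto>\<index>" 60)
  one :: 'a  ("\<one>\<index>")
  zero :: 'a  ("\<zero>\<index>")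

definition hle :: "'a heyting \<Rightarrow> 'a \<Rightarrow> 'a \<Rightarrow> bool"  (infix "\<sqsubseteq>\<index>" 50) where
  "a \<sqsubseteq>\<^bsub>A\<^esub> b \<longleftrightarrow> a \<sqinter>\<^bsub>A\<^esub> b = a"

locale heyting_algebra =
  fixes A :: "'a heyting" (structure)
  assumes join_closed: "\<lbrakk>a \<in> carr A; b \<in> carr A\<rbrakk> \<Longrightarrow> a \<squnion> b \<in> carr A"
    and meet_closed: "\<lbrakk>a \<in> carr A; b \<in> carr A\<rbrakk> \<Longrightarrow> a \<sqinter> b \<in> carr A"
    and himp_closed: "\<lbrakk>a \<in> carr A; b \<in> carr A\<rbrakk> \<Longrightarrow> a \<leadsto> b \<in> carr A"
    and one_closed: "\<one> \<in> carr A"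
    and zero_closed: "\<zero> \<in> carr A"
    and join_assoc:
      "\<lbrakk>a \<in> carr A; b \<in> carr A; c \<in> carr A\<rbrakk> \<Longrightarrow> (a \<squnion> b) \<squnion> c = a \<squnion> (b \<squnion> c)"
    and meet_assoc:
      "\<lbrakk>a \<in> carr A; b \<in> carr A; c \<in> carr A\<rbrakk> \<Longrightarrow> (a \<sqinter> b) \<sqinter> c = a \<sqinter> (b \<sqinter> c)"
    and join_commute: "\<lbrakk>a \<in> carr A; b \<in> carr A\<rbrakk> \<Longrightarrow> a \<squnion> b = b \<squnion> a"
    and meet_commute: "\<lbrakk>a \<in> carr A; b \<in> carr A\<rbrakk> \<Longrightarrow> a \<sqinter> b = b \<sqinter> a"
    and join_absorb: "\<lbrakk>a \<in> carr A; b \<in> carr A\<rbrakk> \<Longrightarrow> a \<squnion> (a \<sqinter> b) = a"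
    and meet_absorb: "\<lbrakk>a \<in> carr A; b \<in> carr A\<rbrakk> \<Longrightarrow> a \<sqinter> (a \<squnion> b) = a"
    and meet_join_distrib:
      "\<lbrakk>a \<in> carr A; b \<in> carr A; c \<in> carr A\<rbrakk>
        \<Longrightarrow> a \<sqinter> (b \<squnion> c) = (a \<sqinter> b) \<squnion> (a \<sqinter> c)"
    and meet_one: "a \<in> carr A \<Longrightarrow> a \<sqinter> \<one> = a"
    and join_zero: "a \<in> carr A \<Longrightarrow> a \<squnion> \<zero> = a"
    and adjoint:
      "\<lbrakk>a \<in> carr A; b \<in> carr A; c \<in> carr A\<rbrakk>
        \<Longrightarrow> c \<sqinter> a \<sqsubseteq> b \<longleftrightarrow> c \<sqsubseteq> a \<leadsto> b"

definition heyting_hom :: "'a heyting \<Rightarrow> 'b heyting \<Rightarrow> ('a \<Rightarrow> 'b) \<Rightarrow> bool" where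
  "heyting_hom A B f \<longleftrightarrow>
    f \<in> carr A \<rightarrow>\<^sub>E carr B \<and>
    (\<forall>a\<in>carr A. \<forall>b\<in>carr A. f (a \<sqinter>\<^bsub>A\<^esub> b) = f a \<sqinter>\<^bsub>B\<^esub> f b) \<and>
    (\<forall>a\<in>carr A. \<forall>b\<in>carr A. f (a \<squnion>\<^bsub>A\<^esub> b) = f a \<squnion>\<^bsub>B\<^esub> f b) \<and>
    (\<forall>a\<in>carr A. \<forall>b\<in>carr A. f (a \<leadsto>\<^bsub>A\<^esub> b) = f a \<leadsto>\<^bsub>B\<^esub> f b) \<and>
    f \<zero>\<^bsub>A\<^esub> = \<zero>\<^bsub>B\<^esub>"

text \<open>
  The bounded distributive lattice homomorphisms into the two-element algebra
  \<open>{0, 1}\<close>, which is represented by \<open>bool\<close>, with the pointwise order.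
\<close>

definition Hom2 :: "'a heyting \<Rightarrow> ('a \<Rightarrow> bool) set" where
  "Hom2 A =
    {h \<in> carr A \<rightarrow>\<^sub>E UNIV.
      (\<forall>a\<in>carr A. \<forall>b\<in>carr A. h (a \<sqinter>\<^bsub>A\<^esub> b) = (h a \<and> h b)) \<and>
      (\<forall>a\<in>carr A. \<forall>b\<in>carr A. h (a \<squnion>\<^bsub>A\<^esub> b) = (h a \<or> h b)) \<and>
      h \<one>\<^bsub>A\<^esub> = True \<and> h \<zero>\<^bsub>A\<^esub> = False}"

definition Hom2_le :: "'a heyting \<Rightarrow> ('a \<Rightarrow> bool) \<Rightarrow> ('a \<Rightarrow> bool) \<Rightarrow> bool" where
  "Hom2_le A h1 h2 \<longleftrightarrow> (\<forall>a\<in>carr A. h1 a \<le> h2 a)"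


section \<open>I-topological systems\<close>

record ('x, 'a) top_system =
  pts :: "'x set"
  sat :: "('x \<times> 'a) set"
  alg :: "'a heyting"

definition p_star :: "('x, 'a) top_system \<Rightarrow> 'x \<Rightarrow> 'a \<Rightarrow> bool" where
  "p_star S x = (\<lambda>a\<in>carr (alg S). (x, a) \<in> sat S)"

locale i_topological_system =
  fixes S :: "('x, 'a) top_system"
  assumes pts_nonempty: "pts S \<noteq> {}"
    and heyting: "heyting_algebra (alg S)"
    and sat_subset: "sat S \<subseteq> pts S \<times> carr (alg S)"
    and sat_zero: "x \<in> pts S \<Longrightarrow> (x, \<zero>\<^bsub>alg S\<^esub>) \<notin> sat S"
    and sat_meet:
      "\<lbrakk>x \<in> pts S; a \<in> carr (alg S); b \<in> carr (alg S)\<rbrakk>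
        \<Longrightarrow> (x, a \<sqinter>\<^bsub>alg S\<^esub> b) \<in> sat S \<longleftrightarrow> (x, a) \<in> sat S \<and> (x, b) \<in> sat S"
    and sat_join:
      "\<lbrakk>x \<in> pts S; a \<in> carr (alg S); b \<in> carr (alg S)\<rbrakk>
        \<Longrightarrow> (x, a \<squnion>\<^bsub>alg S\<^esub> b) \<in> sat S \<longleftrightarrow> (x, a) \<in> sat S \<or> (x, b) \<in> sat S"
    and sat_himp:
      "\<lbrakk>x \<in> pts S; a \<in> carr (alg S); b \<in> carr (alg S)\<rbrakk>
        \<Longrightarrow> (x, a \<leadsto>\<^bsub>alg S\<^esub> b) \<in> sat S \<longleftrightarrow>
            (\<forall>y \<in> pts S. Hom2_le (alg S) (p_star S x) (p_star S y) \<longrightarrow>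
              (y, a) \<notin> sat S \<or> (y, b) \<in> sat S)"

definition heyting_algebraic :: "('x, 'a) top_system \<Rightarrow> bool" where
  "heyting_algebraic S \<longleftrightarrow> bij_betw (p_star S) (pts S) (Hom2 (alg S))"

definition system_morphism ::
  "('x, 'a) top_system \<Rightarrow> ('y, 'b) top_system \<Rightarrow> ('x \<Rightarrow> 'y) \<times> ('b \<Rightarrow> 'a) \<Rightarrow> bool" where
  "system_morphism S T = (\<lambda>(f1, f2).
    f1 \<in> pts S \<rightarrow>\<^sub>E pts T \<and>
    heyting_hom (alg T) (alg S) f2 \<and>
    (\<forall>x \<in> pts S. \<forall>b \<in> carr (alg T). (x, f2 b) \<in> sat S \<longleftrightarrow> (f1 x, b) \<in> sat T))"

text \<open>
  Points range over subsets of \<open>'x\<close> and algebras over subsets of \<open>'a\<close>. To be the counterpart of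
  all Esakia spaces on subsets of \<open>'x\<close>, the type \<open>'a\<close> must have room for their algebras of
  clopen up-sets, for instance \<open>'a = 'x set\<close>.
\<close>

definition HI_TopSys :: "(('x, 'a) top_system, ('x \<Rightarrow> 'x) \<times> ('a \<Rightarrow> 'a)) cat" where
  "HI_TopSys =
    \<lparr>obj = {S. i_topological_system S \<and> heyting_algebraic S},
     hom = (\<lambda>S T. {f. system_morphism S T f}),
     ide = (\<lambda>S. (\<lambda>x\<in>pts S. x, \<lambda>a\<in>carr (alg S). a)),
     comp = (\<lambda>S T U (g1, g2) (f1, f2).
       (compose (pts S) g1 f1, compose (carr (alg U)) f2 g2))\<rparr>"

end

theory Submission
  imports Defs "HOL-Analysis.Function_Topology"
begin

text \<open>
  A Heyting algebraic system is turned into an Esakia space on the same points: the topology is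
  generated by the extents \<open>{x. x \<Turnstile> a}\<close> and their complements, and the order compares the
  homomorphisms \<open>p\<^sup>* x\<close>. Condition (4) on systems says exactly that the down-set of
  \<open>extent a - extent b\<close> is the complement of \<open>extent (a \<rightarrow> b)\<close>. Prime filter separation makes
  the space compact and the extent map injective, and by compactness every clopen up-set is an
  extent. Hence the functor that forgets the algebra part of a morphism is fully faithful: the
  preimage of an extent under an Esakia morphism is a clopen up-set, thus the extent of a unique
  element. The functor is onto on objects, since an Esakia space is recovered from the system of its
  points and its (coded) clopen up-sets.
\<close>

section \<open>Fully faithful functors surjective on objects\<close>

text \<open>The delicate point is the bounded condition for a system morphism. Morphisms of systems
  do not mention the order, so the point above \<open>x\<close> that is sent to \<open>y\<close> has
  to be produced from the algebras. It comes from prime filter separation, applied to the filter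
  generated by what holds at \<open>x\<close> together with the images of what holds at
  \<open>y\<close>, and to the ideal generated by the images of what fails at \<open>y\<close>.
  These two are disjoint because the algebra map preserves implication; a mere lattice homomorphism
  yields in general only a continuous monotone map. Algebraicity enters twice: surjectivity of
  \<open>p_star\<close> turns each prime filter into a point, and injectivity makes the order on
  points antisymmetric. Clopen up-sets have to be coded because the type of algebra elements is
  fixed in advance. The functor keeps only points, topology and order, so it does not see the codes,
  and an Esakia space is recovered up to equality, not only up to isomorphism.\<close>

lemma equivalent_categories_if_fully_faithful_surj:
  fixes C :: "('o1, 'm1) cat" and D :: "('o2, 'm2) cat"
  assumes C: "category C" and D: "category D" and F: "cat_functor C D F"
    and ff: "\<And>a b. \<lbrakk>a \<in> obj C; b \<in> obj C\<rbrakk>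
      \<Longrightarrow> bij_betw (on_hom F a b) (hom C a b) (hom D (on_obj F a) (on_obj F b))"
    and surj: "\<And>d. d \<in> obj D \<Longrightarrow> \<exists>a\<in>obj C. on_obj F a = d"
  shows "equivalent_categories C D"
proof -
  interpret C: category C by fact
  interpret D: category D by fact
  interpret F: cat_functor C D F by fact
  have "\<forall>d\<in>obj D. \<exists>a. a \<in> obj C \<and> on_obj F a = d"
    using surj by blast
  then obtain g where g: "\<And>d. d \<in> obj D \<Longrightarrow> g d \<in> obj C"
      "\<And>d. d \<in> obj D \<Longrightarrow> on_obj F (g d) = d"
    unfolding bchoice_iff by blast
  \<comment> \<open>\<open>F\<close> is bijective on hom-sets and \<open>L a b\<close> inverts it
    there. Equations between composites in \<open>C\<close> are then checked after applying
    \<open>F\<close>.\<close>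
  define L where "L a b k = inv_into (hom C a b) (on_hom F a b) k" for a b k
  have L_hom: "L a b k \<in> hom C a b" and F_L: "on_hom F a b (L a b k) = k"
    if "a \<in> obj C" "b \<in> obj C" "k \<in> hom D (on_obj F a) (on_obj F b)" for a b k
    using ff[OF that(1,2)] that(3) unfolding L_def bij_betw_def
    by (simp_all add: inv_into_into f_inv_into_f)
  have F_inj: "f = f'"
    if "on_hom F a b f = on_hom F a b f'" "a \<in> obj C" "b \<in> obj C" "f \<in> hom C a b" "f' \<in> hom C a b"
    for a b f f'
    using ff[OF that(2,3)] that by (auto simp: bij_betw_def dest: inj_onD)
  define G where "G = \<lparr>on_obj = g, on_hom = (\<lambda>d d'. L (g d) (g d'))\<rparr>"
  have G_hom: "L (g d) (g d') k \<in> hom C (g d) (g d')"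
    and F_G: "on_hom F (g d) (g d') (L (g d) (g d') k) = k"
    if "d \<in> obj D" "d' \<in> obj D" "k \<in> hom D d d'" for d d' k
    using L_hom[of "g d" "g d'" k] F_L[of "g d" "g d'" k] that g by simp_all
  have functor_G: "cat_functor D C G"
  proof
    fix d assume d: "d \<in> obj D"
    show "on_obj G d \<in> obj C"
      using d g by (simp add: G_def)
    show "on_hom G d d (ide D d) = ide C (on_obj G d)"
      unfolding G_def
      by (simp, rule F_inj[of "g d" "g d"])
        (use d g F_G[OF d d] F.on_hom_ide in \<open>simp_all add: G_hom D.ide_in_hom C.ide_in_hom\<close>)
  next
    fix d d' k assume "d \<in> obj D" "d' \<in> obj D" "k \<in> hom D d d'"
    then show "on_hom G d d' k \<in> hom C (on_obj G d) (on_obj G d')"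
      by (simp add: G_def G_hom)
  next
    fix d1 d2 d3 k l
    assume d: "d1 \<in> obj D" "d2 \<in> obj D" "d3 \<in> obj D" and k: "k \<in> hom D d1 d2" and l: "l \<in> hom D d2 d3"
    show "on_hom G d1 d3 (comp D d1 d2 d3 l k) =
        comp C (on_obj G d1) (on_obj G d2) (on_obj G d3) (on_hom G d2 d3 l) (on_hom G d1 d2 k)"
      unfolding G_def
      by (simp, rule F_inj[of "g d1" "g d3"])
        (use d k l g in \<open>simp_all add: F_G G_hom F.on_hom_comp D.comp_in_hom C.comp_in_hom[where b = "g d2"]\<close>)
  qed
  \<comment> \<open>The objects \<open>a\<close> and \<open>g (on_obj F a)\<close> have the same
    image under \<open>F\<close>, so the identity of that image lifts to a morphism in each
    direction. By faithfulness the two lifts are mutually inverse.\<close>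
  define \<eta> where "\<eta> a = L a (g (on_obj F a)) (ide D (on_obj F a))" for a
  define \<theta> where "\<theta> a = L (g (on_obj F a)) a (ide D (on_obj F a))" for a
  note [simp] = F.on_obj_closed F.on_hom_closed g D.ide_in_hom C.ide_in_hom G_hom F_G
    D.comp_ide_left D.comp_ide_right F.on_hom_ide
  have \<eta>: "\<eta> a \<in> hom C a (g (on_obj F a))"
      "on_hom F a (g (on_obj F a)) (\<eta> a) = ide D (on_obj F a)"
    and \<theta>: "\<theta> a \<in> hom C (g (on_obj F a)) a"
      "on_hom F (g (on_obj F a)) a (\<theta> a) = ide D (on_obj F a)"
    if "a \<in> obj C" for a
    using L_hom F_L that by (simp_all add: \<eta>_def \<theta>_def)
  have "natural_isomorphism C C id_func (comp_func G F) \<eta>"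
  proof
    fix a assume a: "a \<in> obj C"
    have "comp C a (g (on_obj F a)) a (\<theta> a) (\<eta> a) = ide C a"
      by (rule F_inj[of a a])
        (use a \<eta> \<theta> in \<open>simp_all add: F.on_hom_comp C.comp_in_hom[where b = "g (on_obj F a)"]\<close>)
    moreover have "comp C (g (on_obj F a)) a (g (on_obj F a)) (\<eta> a) (\<theta> a) = ide C (g (on_obj F a))"
      by (rule F_inj[of "g (on_obj F a)" "g (on_obj F a)"])
        (use a \<eta> \<theta> in \<open>simp_all add: F.on_hom_comp C.comp_in_hom[where b = a]\<close>)
    ultimately show "iso_in C (on_obj id_func a) (on_obj (comp_func G F) a) (\<eta> a)"
      using \<eta> \<theta> a by (auto simp: iso_in_def id_func_def comp_func_def G_def)
  next
    fix a b f assume ab: "a \<in> obj C" "b \<in> obj C" and f: "f \<in> hom C a b"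
    have Gf: "L (g (on_obj F a)) (g (on_obj F b)) (on_hom F a b f)
        \<in> hom C (g (on_obj F a)) (g (on_obj F b))"
      using ab f by simp
    show "comp C (on_obj id_func a) (on_obj id_func b) (on_obj (comp_func G F) b)
          (\<eta> b) (on_hom id_func a b f) =
        comp C (on_obj id_func a) (on_obj (comp_func G F) a) (on_obj (comp_func G F) b)
          (on_hom (comp_func G F) a b f) (\<eta> a)"
      unfolding id_func_def comp_func_def G_def
      by (simp, rule F_inj[of a "g (on_obj F b)"])
        (use ab f Gf \<eta> in \<open>simp_all add: F.on_hom_comp C.comp_in_hom[where b = b]
           C.comp_in_hom[where b = "g (on_obj F a)"]\<close>)
  qed
  \<comment> \<open>On objects and morphisms of \<open>D\<close>, applying \<open>G\<close> and then
    \<open>F\<close> changes nothing, so identities serve as components.\<close>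
  moreover have "natural_isomorphism D D (comp_func F G) id_func (ide D)"
    by standard (auto simp: iso_in_def id_func_def comp_func_def G_def intro!: bexI[where x = "ide D _"])
  ultimately show ?thesis
    using C D F functor_G unfolding equivalent_categories_def by blast
qed

section \<open>Compactness\<close>

text \<open>Directedness absorbs a finite subcover into a single member. In the applications this
  member is often named by one algebra element, or by a pair of them, and directedness comes from
  meets and joins.\<close>

lemma compactin_directed_cover:
  assumes K: "compactin X K" and opn: "\<And>j. j \<in> J \<Longrightarrow> openin X (f j)" and ne: "J \<noteq> {}"
    and dir: "\<And>i j. \<lbrakk>i \<in> J; j \<in> J\<rbrakk> \<Longrightarrow> \<exists>k\<in>J. f i \<union> f j \<subseteq> f k"
    and cover: "\<And>x. x \<in> K \<Longrightarrow> \<exists>j\<in>J. x \<in> f j"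
  shows "\<exists>j\<in>J. K \<subseteq> f j"
proof -
  obtain \<F> where "finite \<F>" "\<F> \<subseteq> f ` J" "K \<subseteq> \<Union>\<F>"
    using compactinD[OF K, of "f ` J"] opn cover by blast
  then obtain J' where J': "finite J'" "J' \<subseteq> J" "K \<subseteq> \<Union>(f ` J')"
    by (metis finite_subset_image)
  from J'(1,2) have "\<exists>j\<in>J. \<Union>(f ` J') \<subseteq> f j"
  proof (induction rule: finite_induct)
    case empty
    then show ?case using ne by auto
  next
    case (insert i I)
    then obtain j where "j \<in> J" "\<Union>(f ` I) \<subseteq> f j"
      by auto
    moreover obtain k where "k \<in> J" "f i \<union> f j \<subseteq> f k"
      using dir[of i j] insert.prems \<open>j \<in> J\<close> by auto
    ultimately show ?case
      by (intro bexI[of _ k]) auto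
  qed
  then show ?thesis
    using J'(3) by blast
qed

text \<open>Alexander's subbase theorem speaks of unions of finite intersections taken relative to
  \<open>\<Union>\<B>\<close>. The work lies in identifying those sets with the inductively
  generated open sets.\<close>

lemma compact_space_topology_generated_by:
  assumes fin: "\<And>C. \<lbrakk>C \<subseteq> \<B>; \<Union>C = \<Union>\<B>\<rbrakk> \<Longrightarrow> \<exists>C'. finite C' \<and> C' \<subseteq> C \<and> \<Union>C' = \<Union>\<B>"
  shows "compact_space (topology_generated_by \<B>)"
proof (rule Alexander_subbase)
  let ?R = "arbitrary union_of (finite intersection_of (\<lambda>x. x \<in> \<B>) relative_to \<Union>\<B>)"
  have R: "istopology ?R"
    by (rule istopology_subbase)
  have "?R W \<longleftrightarrow> generate_topology_on \<B> W" for W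
  proof
    assume "?R W"
    then obtain \<U> where \<U>: "W = \<Union>\<U>"
        "\<And>U. U \<in> \<U> \<Longrightarrow> (finite intersection_of (\<lambda>x. x \<in> \<B>) relative_to \<Union>\<B>) U"
      by (force simp: union_of_def arbitrary_def)
    have "openin (topology_generated_by \<B>) U" if "U \<in> \<U>" for U
    proof -
      obtain \<F> where \<F>: "finite \<F>" "\<F> \<subseteq> \<B>" "U = \<Union>\<B> \<inter> \<Inter>\<F>"
        using \<U>(2)[OF \<open>U \<in> \<U>\<close>] by (auto simp: relative_to_def intersection_of_def)
      show ?thesis
      \<comment> \<open>The empty intersection, relative to \<open>\<Union>\<B>\<close>, is the
        whole space; \<open>openin_Inter\<close> covers nonempty families.\<close>
      proof (cases "\<F> = {}")
        case True
        with \<F> show ?thesis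
          by (metis Inter_empty inf_top_right openin_topspace topology_generated_by_topspace)
      next
        case False
        with \<F> show ?thesis
          by (auto intro!: openin_Int openin_Inter simp: topology_generated_by_Basis)
      qed
    qed
    then show "generate_topology_on \<B> W"
      using \<U>(1) by (metis openin_Union openin_topology_generated_by_iff)
  next
    assume W: "generate_topology_on \<B> W"
    show "?R W"
    proof (rule generate_topology_on_coarsest[OF R _ W])
      fix U assume "U \<in> \<B>"
      then have "(finite intersection_of (\<lambda>x. x \<in> \<B>) relative_to \<Union>\<B>) U"
        by (metis Sup_upper finite_intersection_of_inc inf.absorb_iff2 relative_to_inc)
      then show "?R U"
        by (rule arbitrary_union_of_inc)
    qed
  qed
  then show "topology ?R = topology_generated_by \<B>"
    by (intro arg_cong[where f = topology] ext)
qed (use fin in simp)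

section \<open>Prime filter separation\<close>

text \<open>Upward closure is expressed through joins with arbitrary elements, which avoids the
  order; ideals are treated dually. Neither has to be proper.\<close>

definition lattice_filter :: "'a heyting \<Rightarrow> 'a set \<Rightarrow> bool" where
  "lattice_filter A M \<longleftrightarrow> M \<subseteq> carr A \<and> \<one>\<^bsub>A\<^esub> \<in> M \<and>
    (\<forall>a\<in>M. \<forall>b\<in>M. a \<sqinter>\<^bsub>A\<^esub> b \<in> M) \<and> (\<forall>a\<in>M. \<forall>b\<in>carr A. a \<squnion>\<^bsub>A\<^esub> b \<in> M)"

definition lattice_ideal :: "'a heyting \<Rightarrow> 'a set \<Rightarrow> bool" where
  "lattice_ideal A I \<longleftrightarrow> I \<subseteq> carr A \<and> \<zero>\<^bsub>A\<^esub> \<in> I \<and>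
    (\<forall>a\<in>I. \<forall>b\<in>I. a \<squnion>\<^bsub>A\<^esub> b \<in> I) \<and> (\<forall>a\<in>I. \<forall>b\<in>carr A. a \<sqinter>\<^bsub>A\<^esub> b \<in> I)"

context heyting_algebra
begin

lemma meet_idem: "a \<in> carr A \<Longrightarrow> a \<sqinter> a = a"
  by (metis join_zero meet_absorb zero_closed)

lemma meet_left_commute:
  "\<lbrakk>a \<in> carr A; b \<in> carr A; c \<in> carr A\<rbrakk> \<Longrightarrow> a \<sqinter> (b \<sqinter> c) = b \<sqinter> (a \<sqinter> c)"
  by (metis meet_assoc meet_commute)

text \<open>The equation says that \<open>c\<close> lies above \<open>m \<sqinter> a\<close>, so
  this is the filter generated by \<open>M\<close> and \<open>a\<close>. It is the competitor
  against which a maximal filter is tested.\<close>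

lemma lattice_filter_adjoin:
  assumes M: "lattice_filter A M" and a: "a \<in> carr A"
  shows "lattice_filter A {c \<in> carr A. \<exists>m\<in>M. m \<sqinter> a \<sqinter> c = m \<sqinter> a}"
proof -
  have MA: "m \<in> carr A" if "m \<in> M" for m
    using M that by (auto simp: lattice_filter_def)
  have "\<exists>k\<in>M. k \<sqinter> a \<sqinter> (c \<sqinter> d) = k \<sqinter> a"
    if "c \<in> carr A" "d \<in> carr A" "m \<in> M" "n \<in> M" "m \<sqinter> a \<sqinter> c = m \<sqinter> a" "n \<sqinter> a \<sqinter> d = n \<sqinter> a"
    for c d m n
  proof
    note cl = that(1-4) MA[OF that(3)] MA[OF that(4)] a meet_closed
    show "m \<sqinter> n \<in> M"
      using M that by (simp add: lattice_filter_def)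
    \<comment> \<open>First \<open>c\<close> is moved next to \<open>m \<sqinter> a\<close> and
      absorbed there, then \<open>d\<close> next to \<open>n \<sqinter> a\<close>.\<close>
    have "m \<sqinter> n \<sqinter> a \<sqinter> (c \<sqinter> d) = n \<sqinter> d \<sqinter> (m \<sqinter> a \<sqinter> c)"
      using cl by (simp add: meet_assoc meet_commute meet_left_commute)
    also have "\<dots> = m \<sqinter> (n \<sqinter> a \<sqinter> d)"
      using cl that(5) by (simp add: meet_assoc meet_commute meet_left_commute)
    also have "\<dots> = m \<sqinter> n \<sqinter> a"
      using cl that(6) by (simp add: meet_assoc)
    finally show "m \<sqinter> n \<sqinter> a \<sqinter> (c \<sqinter> d) = m \<sqinter> n \<sqinter> a" .
  qed
  moreover have "\<exists>m\<in>M. m \<sqinter> a \<sqinter> (c \<squnion> d) = m \<sqinter> a"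
    if "c \<in> carr A" "d \<in> carr A" "m \<in> M" "m \<sqinter> a \<sqinter> c = m \<sqinter> a" for c d m
    using that a MA[OF that(3)]
    by (intro bexI[of _ m]) (simp_all add: meet_join_distrib meet_closed join_absorb)
  moreover have "\<exists>m\<in>M. m \<sqinter> a \<sqinter> \<one> = m \<sqinter> a"
    using M MA a by (auto simp: lattice_filter_def meet_one meet_closed)
  ultimately show ?thesis
    by (auto simp: lattice_filter_def join_closed meet_closed one_closed)
qed

lemma prime_filter_imp_Hom2:
  assumes M: "lattice_filter A M" and zero: "\<zero> \<notin> M"
    and prime: "\<And>a b. \<lbrakk>a \<in> carr A; b \<in> carr A; a \<squnion> b \<in> M\<rbrakk> \<Longrightarrow> a \<in> M \<or> b \<in> M"
  shows "(\<lambda>a\<in>carr A. a \<in> M) \<in> Hom2 A"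
proof -
  \<comment> \<open>Absorption writes \<open>a\<close> as a join with \<open>a \<sqinter> b\<close>,
    so upward closure returns the factors of a meet.\<close>
  have "a \<sqinter> b \<in> M \<longleftrightarrow> a \<in> M \<and> b \<in> M" if "a \<in> carr A" "b \<in> carr A" for a b
    using M that unfolding lattice_filter_def
    by (metis join_absorb join_commute meet_closed meet_commute)
  moreover have "a \<squnion> b \<in> M \<longleftrightarrow> a \<in> M \<or> b \<in> M" if "a \<in> carr A" "b \<in> carr A" for a b
    using M that prime unfolding lattice_filter_def by (metis join_commute)
  ultimately show ?thesis
    using M zero
    by (auto simp: Hom2_def lattice_filter_def meet_closed join_closed one_closed zero_closed)
qed

text \<open>Zorn's lemma gives a filter \<open>N\<close> maximal among those that include
  \<open>M\<close> and avoid \<open>I\<close>. Distributivity makes it prime, and \<open>h\<close>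
  is its characteristic function.\<close>

lemma prime_filter_separation:
  assumes M: "lattice_filter A M" and I: "lattice_ideal A I" and disj: "M \<inter> I = {}"
  obtains h where "h \<in> Hom2 A" "\<And>a. a \<in> M \<Longrightarrow> h a" "\<And>a. a \<in> I \<Longrightarrow> \<not> h a"
proof -
  let ?Z = "{N. lattice_filter A N \<and> M \<subseteq> N \<and> N \<inter> I = {}}"
  have "\<exists>N\<in>?Z. \<forall>X\<in>?Z. N \<subseteq> X \<longrightarrow> X = N"
  proof (rule subset_Zorn_nonempty)
    show "?Z \<noteq> {}"
      using M disj by blast
    fix \<C> assume ne: "\<C> \<noteq> {}" and ch: "subset.chain ?Z \<C>"
    then have Z: "\<C> \<subseteq> ?Z" and tot: "\<And>U V. \<lbrakk>U \<in> \<C>; V \<in> \<C>\<rbrakk> \<Longrightarrow> U \<subseteq> V \<or> V \<subseteq> U"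
      by (auto simp: subset_chain_def)
    have "a \<sqinter> b \<in> \<Union>\<C>" if "a \<in> \<Union>\<C>" "b \<in> \<Union>\<C>" for a b
    proof -
      obtain U V where "U \<in> \<C>" "V \<in> \<C>" "a \<in> U" "b \<in> V"
        using \<open>a \<in> \<Union>\<C>\<close> \<open>b \<in> \<Union>\<C>\<close> by blast
      then obtain W where "W \<in> \<C>" "a \<in> W" "b \<in> W"
        using tot[of U V] by blast
      then show ?thesis
        using Z unfolding lattice_filter_def by blast
    qed
    moreover have "\<Union>\<C> \<subseteq> carr A" "\<one> \<in> \<Union>\<C>" "\<forall>a\<in>\<Union>\<C>. \<forall>b\<in>carr A. a \<squnion> b \<in> \<Union>\<C>"
        "M \<subseteq> \<Union>\<C>" "\<Union>\<C> \<inter> I = {}"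
      using ne Z unfolding lattice_filter_def by blast+
    ultimately show "\<Union>\<C> \<in> ?Z"
      unfolding lattice_filter_def by blast
  qed
  then obtain N where N: "lattice_filter A N" "M \<subseteq> N" "N \<inter> I = {}"
    and N_max: "\<forall>X\<in>?Z. N \<subseteq> X \<longrightarrow> X = N"
    by auto
  have max: "X = N" if "lattice_filter A X" "M \<subseteq> X" "X \<inter> I = {}" "N \<subseteq> X" for X
    using N_max that by simp
  have NA: "N \<subseteq> carr A" and IA: "I \<subseteq> carr A"
    using N(1) I by (auto simp: lattice_filter_def lattice_ideal_def)
  \<comment> \<open>By maximality the filter generated by \<open>N\<close> and \<open>a\<close> must
    meet \<open>I\<close>. An element of \<open>I\<close> in it lies above some
    \<open>m \<sqinter> a\<close>, which is therefore in \<open>I\<close> too.\<close>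
  have meets_I: "\<exists>m\<in>N. m \<sqinter> a \<in> I" if a: "a \<in> carr A" "a \<notin> N" for a
  proof -
    let ?X = "{c \<in> carr A. \<exists>m\<in>N. m \<sqinter> a \<sqinter> c = m \<sqinter> a}"
    have "\<one> \<in> N"
      using N(1) by (simp add: lattice_filter_def)
    then have "a \<in> ?X"
      using a by (auto intro!: bexI[of _ \<one>] simp: one_closed meet_assoc meet_idem)
    have "N \<subseteq> ?X"
    proof
      fix c assume "c \<in> N"
      then have "c \<in> carr A" using NA by blast
      then have "c \<sqinter> a \<sqinter> c = c \<sqinter> a"
        using a by (metis meet_assoc meet_commute meet_idem)
      then show "c \<in> ?X"
        using \<open>c \<in> N\<close> \<open>c \<in> carr A\<close> by blast
    qed
    moreover have "?X \<noteq> N"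
      using \<open>a \<in> ?X\<close> a by blast
    ultimately have "?X \<inter> I \<noteq> {}"
      using max[OF lattice_filter_adjoin[OF N(1) a(1)]] N(2) by blast
    then obtain c m where c: "c \<in> I" "c \<in> carr A" "m \<in> N" "m \<sqinter> a \<sqinter> c = m \<sqinter> a"
      by blast
    then have "c \<sqinter> (m \<sqinter> a) \<in> I"
      using I NA a by (auto simp: lattice_ideal_def meet_closed)
    then have "m \<sqinter> a \<in> I"
      using c NA a by (metis meet_closed meet_commute subsetD)
    then show ?thesis
      using c(3) by blast
  qed
  have "a \<in> N \<or> b \<in> N" if ab: "a \<in> carr A" "b \<in> carr A" "a \<squnion> b \<in> N" for a b
  proof (rule ccontr)
    assume "\<not> ?thesis"
    then obtain m n where m: "m \<in> N" "m \<sqinter> a \<in> I" and n: "n \<in> N" "n \<sqinter> b \<in> I"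
      using meets_I ab by meson
    have cl: "m \<in> carr A" "n \<in> carr A"
      using m n NA by auto
    \<comment> \<open>Both joinands lie below elements of \<open>I\<close>. By distributivity their
      join is a meet of three elements of \<open>N\<close>, contradicting disjointness.\<close>
    have "(m \<sqinter> a) \<sqinter> n \<squnion> (n \<sqinter> b) \<sqinter> m \<in> I"
      using m n I cl by (simp add: lattice_ideal_def)
    also have "(m \<sqinter> a) \<sqinter> n \<squnion> (n \<sqinter> b) \<sqinter> m = (m \<sqinter> n) \<sqinter> (a \<squnion> b)"
      using cl ab(1,2)
      by (simp add: meet_join_distrib meet_closed meet_assoc meet_commute meet_left_commute)
    finally have "(m \<sqinter> n) \<sqinter> (a \<squnion> b) \<in> I" .
    moreover have "(m \<sqinter> n) \<sqinter> (a \<squnion> b) \<in> N"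
      using N(1) m n ab(3) by (simp add: lattice_filter_def)
    ultimately show False
      using N(3) by blast
  qed
  moreover have "\<zero> \<notin> N"
    using N(3) I by (auto simp: lattice_ideal_def)
  ultimately have "(\<lambda>a\<in>carr A. a \<in> N) \<in> Hom2 A"
    by (intro prime_filter_imp_Hom2 N(1))
  then show thesis
    by (rule that) (use N NA IA in auto)
qed

lemma lattice_filter_above:
  assumes a: "a \<in> carr A"
  shows "lattice_filter A {c \<in> carr A. a \<sqinter> c = a}"
proof -
  have "a \<sqinter> (c \<sqinter> d) = a" if "c \<in> carr A" "d \<in> carr A" "a \<sqinter> c = a" "a \<sqinter> d = a" for c d
    using meet_assoc[OF a that(1,2)] that by simp
  moreover have "a \<sqinter> (c \<squnion> d) = a" if "c \<in> carr A" "d \<in> carr A" "a \<sqinter> c = a" for c d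
    using that a by (simp add: meet_join_distrib join_absorb)
  ultimately show ?thesis
    using a by (simp add: lattice_filter_def meet_one one_closed meet_closed join_closed subset_iff)
qed

lemma lattice_ideal_below:
  assumes b: "b \<in> carr A"
  shows "lattice_ideal A {c \<in> carr A. c \<sqinter> b = c}"
proof -
  have "\<zero> \<sqinter> b = \<zero>"
    using meet_absorb[OF zero_closed b] b by (simp add: join_commute zero_closed join_zero)
  moreover have "(c \<squnion> d) \<sqinter> b = c \<squnion> d"
    if "c \<in> carr A" "d \<in> carr A" "c \<sqinter> b = c" "d \<sqinter> b = d" for c d
    using that b by (metis join_closed meet_commute meet_join_distrib)
  moreover have "(c \<sqinter> d) \<sqinter> b = c \<sqinter> d" if "c \<in> carr A" "d \<in> carr A" "c \<sqinter> b = c" for c d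
    using that b by (metis meet_assoc meet_commute)
  ultimately show ?thesis
    using b by (simp add: lattice_ideal_def zero_closed meet_closed join_closed subset_iff)
qed

end

section \<open>The Esakia space of a system\<close>

definition extent :: "('x, 'a) top_system \<Rightarrow> 'a \<Rightarrow> 'x set" where
  "extent S a = {x \<in> pts S. (x, a) \<in> sat S}"

text \<open>This is the Priestley (patch) topology on prime filters, carried over to the points.
  With extents alone every open set would be an up-set, and extents would in general not be
  closed.\<close>

definition spectral_space :: "('x, 'a) top_system \<Rightarrow> 'x ordered_space" where
  "spectral_space S =
    \<lparr>topo = topology_generated_by
       (extent S ` carr (alg S) \<union> (\<lambda>a. pts S - extent S a) ` carr (alg S)),
     ord = {(x, y) \<in> pts S \<times> pts S. Hom2_le (alg S) (p_star S x) (p_star S y)}\<rparr>"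

locale heyting_algebraic_system = i_topological_system S
  for S :: "('x, 'a) top_system" +
  assumes algebraic: "heyting_algebraic S"
begin

sublocale heyting_algebra "alg S"
  by (rule heyting)

text \<open>The surjective half of algebraicity: every prime filter is realised by a point. The
  injective half is \<open>point_eqI\<close>.\<close>

lemma Hom2_ex_point:
  assumes "h \<in> Hom2 (alg S)"
  obtains x where "x \<in> pts S" "\<And>a. a \<in> carr (alg S) \<Longrightarrow> x \<in> extent S a \<longleftrightarrow> h a"
proof -
  have "p_star S ` pts S = Hom2 (alg S)"
    using algebraic by (simp add: heyting_algebraic_def bij_betw_imp_surj_on)
  with assms obtain x where "x \<in> pts S" "p_star S x = h"
    by (metis imageE)
  then show ?thesis
    by (intro that[of x]) (auto simp: p_star_def extent_def)
qed

lemma point_eqI: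
  assumes "x \<in> pts S" "y \<in> pts S" "\<And>a. a \<in> carr (alg S) \<Longrightarrow> x \<in> extent S a \<longleftrightarrow> y \<in> extent S a"
  shows "x = y"
proof -
  have "p_star S x = p_star S y"
    using assms by (auto simp: p_star_def extent_def restrict_def fun_eq_iff)
  then show ?thesis
    using algebraic assms unfolding heyting_algebraic_def bij_betw_def by (blast dest: inj_onD)
qed

section \<open>Extents under the algebra operations\<close>

lemma extent_subset: "extent S a \<subseteq> pts S"
  by (auto simp: extent_def)

lemma extent_zero: "extent S \<zero>\<^bsub>alg S\<^esub> = {}"
  using sat_zero by (auto simp: extent_def)

text \<open>The conditions on \<open>sat\<close> do not mention the top element; that it holds at
  every point is read off from \<open>p_star\<close> taking values in \<open>Hom2\<close>.\<close>

lemma extent_one: "extent S \<one>\<^bsub>alg S\<^esub> = pts S"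
proof -
  have "p_star S x \<one>\<^bsub>alg S\<^esub>" if "x \<in> pts S" for x
    using algebraic that unfolding heyting_algebraic_def bij_betw_def Hom2_def by blast
  then show ?thesis
    using one_closed by (auto simp: extent_def p_star_def)
qed

lemma extent_meet:
  "\<lbrakk>a \<in> carr (alg S); b \<in> carr (alg S)\<rbrakk> \<Longrightarrow> extent S (a \<sqinter>\<^bsub>alg S\<^esub> b) = extent S a \<inter> extent S b"
  using sat_meet by (auto simp: extent_def)

lemma extent_join:
  "\<lbrakk>a \<in> carr (alg S); b \<in> carr (alg S)\<rbrakk> \<Longrightarrow> extent S (a \<squnion>\<^bsub>alg S\<^esub> b) = extent S a \<union> extent S b"
  using sat_join by (auto simp: extent_def)

lemma ord_spectral_space_iff:
  "(x, y) \<in> ord (spectral_space S) \<longleftrightarrow>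
    x \<in> pts S \<and> y \<in> pts S \<and> (\<forall>a\<in>carr (alg S). x \<in> extent S a \<longrightarrow> y \<in> extent S a)"
  by (auto simp: spectral_space_def Hom2_le_def p_star_def extent_def)

lemma extent_himp:
  assumes "a \<in> carr (alg S)" "b \<in> carr (alg S)"
  shows "extent S (a \<leadsto>\<^bsub>alg S\<^esub> b) =
    {x \<in> pts S. \<forall>y. (x, y) \<in> ord (spectral_space S) \<longrightarrow> y \<in> extent S a \<longrightarrow> y \<in> extent S b}"
  using sat_himp[OF _ assms] by (auto simp: extent_def spectral_space_def)

lemma topspace_spectral_space: "topspace (topo (spectral_space S)) = pts S"
  using extent_one one_closed extent_subset by (fastforce simp: spectral_space_def)

lemma clopenin_extent:
  assumes "a \<in> carr (alg S)"
  shows "clopenin (topo (spectral_space S)) (extent S a)"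
proof -
  have "openin (topo (spectral_space S)) (extent S a)"
      "openin (topo (spectral_space S)) (pts S - extent S a)"
    using assms by (auto simp: spectral_space_def intro!: topology_generated_by_Basis)
  then show ?thesis
    by (simp add: clopenin_def closedin_def extent_subset topspace_spectral_space)
qed

lemma up_set_extent: "a \<in> carr (alg S) \<Longrightarrow> up_set (spectral_space S) (extent S a)"
  by (auto simp: up_set_def topspace_spectral_space ord_spectral_space_iff extent_def)

lemma separating_point:
  assumes "lattice_filter (alg S) M" "lattice_ideal (alg S) I" "M \<inter> I = {}"
  obtains x where "x \<in> pts S" "\<And>a. a \<in> M \<Longrightarrow> x \<in> extent S a" "\<And>a. a \<in> I \<Longrightarrow> x \<notin> extent S a"
proof -
  obtain h where h: "h \<in> Hom2 (alg S)" "\<And>a. a \<in> M \<Longrightarrow> h a" "\<And>a. a \<in> I \<Longrightarrow> \<not> h a"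
    using prime_filter_separation[OF assms] by metis
  obtain x where "x \<in> pts S" "\<And>a. a \<in> carr (alg S) \<Longrightarrow> x \<in> extent S a \<longleftrightarrow> h a"
    using Hom2_ex_point[OF h(1)] by metis
  moreover have "M \<subseteq> carr (alg S)" "I \<subseteq> carr (alg S)"
    using assms by (simp_all add: lattice_filter_def lattice_ideal_def)
  ultimately show ?thesis
    using h by (intro that[of x]) auto
qed

text \<open>If \<open>a\<close> is not below \<open>b\<close>, the principal filter of
  \<open>a\<close> is disjoint from the principal ideal of \<open>b\<close>, and a point separating
  them lies in the extent of \<open>a\<close> but not in that of \<open>b\<close>.\<close>

lemma extent_le_iff:
  assumes a: "a \<in> carr (alg S)" and b: "b \<in> carr (alg S)"
  shows "extent S a \<subseteq> extent S b \<longleftrightarrow> a \<sqinter>\<^bsub>alg S\<^esub> b = a"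
proof
  assume "a \<sqinter>\<^bsub>alg S\<^esub> b = a"
  then show "extent S a \<subseteq> extent S b"
    using extent_meet[OF a b] by auto
next
  assume sub: "extent S a \<subseteq> extent S b"
  let ?M = "{c \<in> carr (alg S). a \<sqinter>\<^bsub>alg S\<^esub> c = a}"
  let ?I = "{c \<in> carr (alg S). c \<sqinter>\<^bsub>alg S\<^esub> b = c}"
  show "a \<sqinter>\<^bsub>alg S\<^esub> b = a"
  proof (rule ccontr)
    assume neq: "a \<sqinter>\<^bsub>alg S\<^esub> b \<noteq> a"
    have False if "c \<in> carr (alg S)" "a \<sqinter>\<^bsub>alg S\<^esub> c = a" "c \<sqinter>\<^bsub>alg S\<^esub> b = c" for c
      using meet_assoc[OF a that(1) b] that neq by simp
    then have disj: "?M \<inter> ?I = {}"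
      by blast
    show False
    proof (rule separating_point[OF lattice_filter_above[OF a] lattice_ideal_below[OF b] disj])
      fix x
      assume x: "\<And>c. c \<in> ?M \<Longrightarrow> x \<in> extent S c" "\<And>c. c \<in> ?I \<Longrightarrow> x \<notin> extent S c"
      show False
        using x(1)[of a] x(2)[of b] sub a b by (auto simp: meet_idem)
    qed
  qed
qed

lemma inj_on_extent: "inj_on (extent S) (carr (alg S))"
proof (rule inj_onI)
  fix a b assume "a \<in> carr (alg S)" "b \<in> carr (alg S)" "extent S a = extent S b"
  then show "a = b"
    using extent_le_iff[of a b] extent_le_iff[of b a] by (simp add: meet_commute)
qed

text \<open>By Alexander's theorem only covers by extents and complements of extents matter. Such a
  cover defines a filter and an ideal; if they were disjoint, a separating point would be left
  uncovered. A common element encodes a finite subcover.\<close>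

lemma compact_spectral_space: "compact_space (topo (spectral_space S))"
proof -
  let ?B = "extent S ` carr (alg S) \<union> (\<lambda>a. pts S - extent S a) ` carr (alg S)"
  have un: "\<Union>?B = pts S"
    using topspace_spectral_space by (simp add: spectral_space_def)
  have "\<exists>C'. finite C' \<and> C' \<subseteq> C \<and> \<Union>C' = pts S" if C: "C \<subseteq> ?B" "\<Union>C = pts S" for C
  proof -
    \<comment> \<open>\<open>P\<close> collects the elements that occur in the cover through
      complements, \<open>N\<close> those that occur through extents. An uncovered point satisfies
      all of \<open>P\<close> and none of \<open>N\<close>.\<close>
    define P where "P = {a \<in> carr (alg S). pts S - extent S a \<in> C}"
    define N where "N = {a \<in> carr (alg S). extent S a \<in> C}"
    \<comment> \<open>The intersection with \<open>pts S\<close> gives the empty family its intended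
      value, the whole space.\<close>
    define M where "M = {c \<in> carr (alg S). \<exists>P'. finite P' \<and> P' \<subseteq> P \<and> pts S \<inter> \<Inter>(extent S ` P') \<subseteq> extent S c}"
    define I where "I = {c \<in> carr (alg S). \<exists>N'. finite N' \<and> N' \<subseteq> N \<and> extent S c \<subseteq> \<Union>(extent S ` N')}"
    have M_meet: "a \<sqinter>\<^bsub>alg S\<^esub> b \<in> M" if ab: "a \<in> M" "b \<in> M" for a b
    proof -
      obtain Q R where "finite Q" "Q \<subseteq> P" "pts S \<inter> \<Inter>(extent S ` Q) \<subseteq> extent S a"
          "finite R" "R \<subseteq> P" "pts S \<inter> \<Inter>(extent S ` R) \<subseteq> extent S b"
        using ab unfolding M_def by blast
      then have "finite (Q \<union> R)" "Q \<union> R \<subseteq> P" "pts S \<inter> \<Inter>(extent S ` (Q \<union> R)) \<subseteq> extent S a \<inter> extent S b"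
        by auto
      then show ?thesis
        using ab by (auto simp: M_def extent_meet meet_closed intro!: exI[of _ "Q \<union> R"])
    qed
    have "lattice_filter (alg S) M"
      unfolding lattice_filter_def using M_meet
      by (auto simp: M_def one_closed extent_one join_closed extent_join)
    moreover
    have I_join: "a \<squnion>\<^bsub>alg S\<^esub> b \<in> I" if ab: "a \<in> I" "b \<in> I" for a b
    proof -
      obtain Q R where "finite Q" "Q \<subseteq> N" "extent S a \<subseteq> \<Union>(extent S ` Q)"
          "finite R" "R \<subseteq> N" "extent S b \<subseteq> \<Union>(extent S ` R)"
        using ab unfolding I_def by blast
      then have "finite (Q \<union> R)" "Q \<union> R \<subseteq> N" "extent S a \<union> extent S b \<subseteq> \<Union>(extent S ` (Q \<union> R))"
        by auto
      then show ?thesis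
        using ab by (auto simp: I_def extent_join join_closed intro!: exI[of _ "Q \<union> R"])
    qed
    have "lattice_ideal (alg S) I"
      unfolding lattice_ideal_def using I_join
      by (auto simp: I_def zero_closed extent_zero meet_closed extent_meet)
    moreover have False if sep: "x \<in> pts S" "\<And>a. a \<in> M \<Longrightarrow> x \<in> extent S a" "\<And>a. a \<in> I \<Longrightarrow> x \<notin> extent S a" for x
    proof -
      have "P \<subseteq> M"
        unfolding P_def M_def by (auto intro!: exI[of _ "{_}"])
      moreover have "N \<subseteq> I"
        unfolding N_def I_def by (auto intro!: exI[of _ "{_}"])
      moreover obtain V where "V \<in> C" "x \<in> V"
        using sep(1) C(2) by blast
      ultimately show False
        using C(1) sep unfolding P_def N_def by blast
    qed
    ultimately have "M \<inter> I \<noteq> {}"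
      by (meson separating_point)
    then obtain c where "c \<in> M" "c \<in> I"
      by blast
    then obtain Q R where Q: "finite Q" "Q \<subseteq> P" "pts S \<inter> \<Inter>(extent S ` Q) \<subseteq> extent S c"
        and R: "finite R" "R \<subseteq> N" "extent S c \<subseteq> \<Union>(extent S ` R)"
      unfolding M_def I_def by blast
    let ?C = "(\<lambda>a. pts S - extent S a) ` Q \<union> extent S ` R"
    have "?C \<subseteq> C"
      using Q(2) R(2) by (auto simp: P_def N_def)
    moreover have "pts S \<subseteq> \<Union>?C"
    proof
      \<comment> \<open>A point in the extent of \<open>c\<close> lies in an extent taken from
        \<open>R\<close>; any other point lies outside some extent taken from
        \<open>Q\<close>.\<close>
      fix x assume "x \<in> pts S"
      then show "x \<in> \<Union>?C"
        using subsetD[OF Q(3), of x] subsetD[OF R(3), of x] by (cases "x \<in> extent S c") auto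
    qed
    moreover have "\<Union>?C \<subseteq> pts S"
      using extent_subset by blast
    ultimately show ?thesis
      using Q(1) R(1) by (intro exI[of _ ?C]) auto
  qed
  then have "compact_space (topology_generated_by ?B)"
    by (intro compact_space_topology_generated_by) (simp only: un)
  then show ?thesis
    by (simp add: spectral_space_def)
qed

text \<open>Compactness is used twice: for the complement of \<open>U\<close>, where meets shrink an
  extent around \<open>x\<close> until it fits into \<open>U\<close>, and for \<open>U\<close>
  itself, where joins merge these extents into one.\<close>

lemma clopen_up_set_is_extent:
  assumes U: "clopenin (topo (spectral_space S)) U" "up_set (spectral_space S) U"
  shows "\<exists>a\<in>carr (alg S). U = extent S a"
proof -
  let ?T = "topo (spectral_space S)"
  have UP: "U \<subseteq> pts S"
    using U(2) by (simp add: up_set_def topspace_spectral_space)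
  have cover: "\<exists>a\<in>carr (alg S). x \<in> extent S a \<and> extent S a \<subseteq> U" if x: "x \<in> U" for x
  proof -
    have "compactin ?T (pts S - U)"
      using U compact_spectral_space
      by (simp add: clopenin_def closedin_compact_space closedin_diff flip: topspace_spectral_space)
    then have "\<exists>a\<in>{a \<in> carr (alg S). x \<in> extent S a}. pts S - U \<subseteq> pts S - extent S a"
    proof (rule compactin_directed_cover)
      \<comment> \<open>Since \<open>U\<close> is an up-set, \<open>y\<close> is not above
        \<open>x\<close>, so by the definition of the order some extent contains \<open>x\<close>
        and misses \<open>y\<close>.\<close>
      fix y assume y: "y \<in> pts S - U"
      then have "(x, y) \<notin> ord (spectral_space S)"
        using U(2) x by (auto simp: up_set_def)
      then show "\<exists>a\<in>{a \<in> carr (alg S). x \<in> extent S a}. y \<in> pts S - extent S a"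
        using x y UP by (auto simp: ord_spectral_space_iff)
    next
      show "{a \<in> carr (alg S). x \<in> extent S a} \<noteq> {}"
        using x UP extent_one one_closed by auto
    next
      fix a b assume "a \<in> {a \<in> carr (alg S). x \<in> extent S a}" "b \<in> {a \<in> carr (alg S). x \<in> extent S a}"
      then show "\<exists>c\<in>{a \<in> carr (alg S). x \<in> extent S a}.
          (pts S - extent S a) \<union> (pts S - extent S b) \<subseteq> pts S - extent S c"
        by (intro bexI[of _ "a \<sqinter>\<^bsub>alg S\<^esub> b"]) (auto simp: extent_meet meet_closed)
    qed (use clopenin_extent in \<open>auto simp: clopenin_def closedin_def topspace_spectral_space\<close>)
    then show ?thesis
      using extent_subset by blast
  qed
  have "compactin ?T U"
    using U compact_spectral_space by (simp add: clopenin_def closedin_compact_space)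
  then have "\<exists>a\<in>{a \<in> carr (alg S). extent S a \<subseteq> U}. U \<subseteq> extent S a"
  proof (rule compactin_directed_cover)
    show "{a \<in> carr (alg S). extent S a \<subseteq> U} \<noteq> {}"
      using extent_zero zero_closed by auto
  next
    fix a b assume "a \<in> {a \<in> carr (alg S). extent S a \<subseteq> U}" "b \<in> {a \<in> carr (alg S). extent S a \<subseteq> U}"
    then show "\<exists>c\<in>{a \<in> carr (alg S). extent S a \<subseteq> U}. extent S a \<union> extent S b \<subseteq> extent S c"
      by (intro bexI[of _ "a \<squnion>\<^bsub>alg S\<^esub> b"]) (auto simp: extent_join join_closed)
  qed (use clopenin_extent cover in \<open>force simp: clopenin_def\<close>)+
  then show ?thesis
    by blast
qed

lemma down_closure_extent_diff:
  assumes "a \<in> carr (alg S)" "b \<in> carr (alg S)"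
  shows "down_closure (spectral_space S) (extent S a - extent S b) = pts S - extent S (a \<leadsto>\<^bsub>alg S\<^esub> b)"
  using assms by (auto simp: down_closure_def extent_himp topspace_spectral_space)

text \<open>The down-closure is computed for differences of extents, and it commutes with unions. It
  remains to exhaust \<open>U\<close> by such differences, which compactness permits.\<close>

lemma clopenin_down_closure_spectral_space:
  assumes U: "clopenin (topo (spectral_space S)) U"
  shows "clopenin (topo (spectral_space S)) (down_closure (spectral_space S) U)"
proof -
  let ?T = "topo (spectral_space S)" and ?down = "down_closure (spectral_space S)"
  \<comment> \<open>Keeping all clopen subsets of \<open>U\<close> with clopen down-closure, not
    just differences of extents, makes the family closed under binary unions and thus
    directed.\<close>
  let ?\<A> = "{W. clopenin ?T W \<and> clopenin ?T (?down W) \<and> W \<subseteq> U}"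
  have UP: "U \<subseteq> pts S"
    using U by (metis clopenin_def closedin_subset topspace_spectral_space)
  have cover: "\<exists>W\<in>?\<A>. x \<in> W" if x: "x \<in> U" for x
  proof -
    let ?I = "{(a, b). a \<in> carr (alg S) \<and> b \<in> carr (alg S) \<and> x \<in> extent S a \<and> x \<notin> extent S b}"
    let ?f = "\<lambda>p. (pts S - extent S (fst p)) \<union> extent S (snd p)"
    have xP: "x \<in> pts S"
      using x UP by blast
    have "compactin ?T (pts S - U)"
      using U compact_spectral_space
      by (simp add: clopenin_def closedin_compact_space closedin_diff flip: topspace_spectral_space)
    then have "\<exists>p\<in>?I. pts S - U \<subseteq> ?f p"
    proof (rule compactin_directed_cover)
      fix y assume y: "y \<in> pts S - U"
      then have "x \<noteq> y"
        using x by blast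
      then obtain a where a: "a \<in> carr (alg S)" "x \<in> extent S a \<longleftrightarrow> y \<notin> extent S a"
        using point_eqI[of x y] xP y by blast
      show "\<exists>p\<in>?I. y \<in> ?f p"
      \<comment> \<open>The separating element may hold at \<open>x\<close> or at \<open>y\<close>.
        The other component of the pair is filled with the bottom or the top element.\<close>
      proof (cases "x \<in> extent S a")
        case True
        then show ?thesis
          using a y by (intro bexI[of _ "(a, \<zero>\<^bsub>alg S\<^esub>)"]) (auto simp: zero_closed extent_zero)
      next
        case False
        then show ?thesis
          using a y xP by (intro bexI[of _ "(\<one>\<^bsub>alg S\<^esub>, a)"]) (auto simp: one_closed extent_one)
      qed
    next
      have "(\<one>\<^bsub>alg S\<^esub>, \<zero>\<^bsub>alg S\<^esub>) \<in> ?I"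
        using xP by (simp add: extent_one one_closed extent_zero zero_closed)
      then show "?I \<noteq> {}"
        by blast
    next
      fix p q assume "p \<in> ?I" "q \<in> ?I"
      then show "\<exists>r\<in>?I. ?f p \<union> ?f q \<subseteq> ?f r"
        by (intro bexI[of _ "(fst p \<sqinter>\<^bsub>alg S\<^esub> fst q, snd p \<squnion>\<^bsub>alg S\<^esub> snd q)"])
          (auto simp: extent_meet meet_closed extent_join join_closed)
    qed (use clopenin_extent in \<open>auto simp: clopenin_def closedin_def topspace_spectral_space intro!: openin_Un\<close>)
    then obtain a b where ab: "a \<in> carr (alg S)" "b \<in> carr (alg S)" "x \<in> extent S a" "x \<notin> extent S b"
        "pts S - U \<subseteq> (pts S - extent S a) \<union> extent S b"
      by auto
    have "clopenin ?T (pts S - extent S (a \<leadsto>\<^bsub>alg S\<^esub> b))"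
      using clopenin_extent[OF himp_closed[OF ab(1,2)]]
      by (simp add: clopenin_def openin_diff closedin_diff flip: topspace_spectral_space)
    moreover have "clopenin ?T (extent S a - extent S b)"
      using clopenin_extent[OF ab(1)] clopenin_extent[OF ab(2)]
      by (simp add: clopenin_def openin_diff closedin_diff)
    moreover have "extent S a - extent S b \<subseteq> U"
      using ab(5) extent_subset by blast
    ultimately show ?thesis
      using ab by (intro bexI[of _ "extent S a - extent S b"]) (simp_all add: down_closure_extent_diff)
  qed
  have "compactin ?T U"
    using U compact_spectral_space by (simp add: clopenin_def closedin_compact_space)
  then have "\<exists>W\<in>?\<A>. U \<subseteq> W"
  proof (rule compactin_directed_cover)
    have "?down {} = {}"
      by (simp add: down_closure_def)
    then have "{} \<in> ?\<A>"
      by (simp add: clopenin_def)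
    then show "?\<A> \<noteq> {}"
      by blast
  next
    fix W W' assume W: "W \<in> ?\<A>" "W' \<in> ?\<A>"
    have "?down (W \<union> W') = ?down W \<union> ?down W'"
      by (auto simp: down_closure_def)
    then have "W \<union> W' \<in> ?\<A>"
      using W by (auto simp: clopenin_def intro: openin_Un closedin_Un)
    then show "\<exists>V\<in>?\<A>. W \<union> W' \<subseteq> V"
      by blast
  qed (use cover in \<open>auto simp: clopenin_def\<close>)
  then obtain W where "W \<subseteq> U" "U \<subseteq> W" "clopenin ?T (?down W)"
    by blast
  then show ?thesis
    by (metis subset_antisym)
qed

lemma esakia_space_spectral_space: "esakia_space (spectral_space S)"
proof
  let ?E = "spectral_space S"
  show "topspace (topo ?E) \<noteq> {}"
    by (simp add: topspace_spectral_space pts_nonempty)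
  have "trans (ord ?E)"
    by (rule transI) (auto simp: ord_spectral_space_iff)
  moreover have "antisym (ord ?E)"
    by (rule antisymI) (auto simp: ord_spectral_space_iff intro: point_eqI)
  moreover have "refl_on (pts S) (ord ?E)" "ord ?E \<subseteq> pts S \<times> pts S"
    by (auto simp: refl_on_def ord_spectral_space_iff)
  ultimately show "partial_order_on (topspace (topo ?E)) (ord ?E)"
    by (simp add: partial_order_on_def preorder_on_def topspace_spectral_space)
next
  let ?E = "spectral_space S"
  fix x y assume "x \<in> topspace (topo ?E)" "y \<in> topspace (topo ?E)" "(x, y) \<notin> ord ?E"
  then obtain a where "a \<in> carr (alg S)" "x \<in> extent S a" "y \<notin> extent S a"
    by (auto simp: ord_spectral_space_iff topspace_spectral_space)
  then show "\<exists>U. clopenin (topo ?E) U \<and> up_set ?E U \<and> x \<in> U \<and> y \<notin> U"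
    using clopenin_extent up_set_extent by blast
qed (use compact_spectral_space clopenin_down_closure_spectral_space in auto)

end

section \<open>Morphisms of systems and Esakia morphisms\<close>

lemma obj_HI_TopSys_iff: "S \<in> obj HI_TopSys \<longleftrightarrow> heyting_algebraic_system S"
  by (simp add: HI_TopSys_def heyting_algebraic_system_def heyting_algebraic_system_axioms_def)

lemma system_morphism_iff_extent:
  "system_morphism S T (f, g) \<longleftrightarrow>
    f \<in> pts S \<rightarrow>\<^sub>E pts T \<and> heyting_hom (alg T) (alg S) g \<and>
    (\<forall>b\<in>carr (alg T). extent S (g b) = {x \<in> pts S. f x \<in> extent T b})"
  by (auto simp: system_morphism_def extent_def)

lemma heyting_hom_closed: "\<lbrakk>heyting_hom A B g; a \<in> carr A\<rbrakk> \<Longrightarrow> g a \<in> carr B"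
  by (auto simp: heyting_hom_def)

locale system_pair =
  S: heyting_algebraic_system S + T: heyting_algebraic_system T
  for S :: "('x, 'a) top_system" and T :: "('y, 'b) top_system"
begin

text \<open>This gives faithfulness: the extent of \<open>g b\<close> is prescribed by
  \<open>f\<close>, and extents determine elements.\<close>

lemma system_morphism_cong_snd:
  assumes fg: "system_morphism S T (f, g)" and fg': "system_morphism S T (f, g')"
  shows "g = g'"
proof (rule PiE_ext)
  show "g \<in> carr (alg T) \<rightarrow>\<^sub>E carr (alg S)" "g' \<in> carr (alg T) \<rightarrow>\<^sub>E carr (alg S)"
    using fg fg' by (simp_all add: system_morphism_iff_extent heyting_hom_def)
  fix b assume b: "b \<in> carr (alg T)"
  have "extent S (g b) = extent S (g' b)"
    using b fg fg' by (simp add: system_morphism_iff_extent)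
  then show "g b = g' b"
    using b fg fg' by (intro inj_onD[OF S.inj_on_extent])
      (auto simp: system_morphism_iff_extent intro: heyting_hom_closed)
qed

text \<open>The point \<open>z\<close> has to satisfy everything that \<open>x\<close> satisfies,
  and \<open>g b\<close> precisely when \<open>y\<close> satisfies \<open>b\<close>. These demands
  form a filter and an ideal, and any point separating them will do.\<close>

lemma spectral_bounded:
  assumes fg: "system_morphism S T (f, g)"
    and x: "x \<in> pts S" and y: "y \<in> pts T" and le: "(f x, y) \<in> ord (spectral_space T)"
  obtains z where "(x, z) \<in> ord (spectral_space S)" "f z = y"
proof -
  let ?le = "\<lambda>x z. (x, z) \<in> ord (spectral_space S)"
  have f: "f z \<in> pts T" if "z \<in> pts S" for z
    using fg that by (auto simp: system_morphism_iff_extent)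
  have hom: "heyting_hom (alg T) (alg S) g"
    and ext: "\<And>b. b \<in> carr (alg T) \<Longrightarrow> extent S (g b) = {x \<in> pts S. f x \<in> extent T b}"
    using fg by (auto simp: system_morphism_iff_extent)
  have le_pts: "z \<in> pts S" if "?le x z" for z
    using that by (simp add: S.ord_spectral_space_iff)
  \<comment> \<open>Membership says that \<open>x\<close> satisfies the implication from
    \<open>g b\<close> to \<open>c\<close> for some \<open>b\<close> true at \<open>y\<close>. This
    describes the filter generated by the elements true at \<open>x\<close> and those
    \<open>g b\<close>.\<close>
  define M where "M = {c \<in> carr (alg S). \<exists>b\<in>carr (alg T). y \<in> extent T b \<and>
    (\<forall>z. ?le x z \<longrightarrow> f z \<in> extent T b \<longrightarrow> z \<in> extent S c)}"
  \<comment> \<open>Read through extents, \<open>c\<close> lies below \<open>g b\<close> for some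
    \<open>b\<close> false at \<open>y\<close>.\<close>
  define I where "I = {c \<in> carr (alg S). \<exists>b\<in>carr (alg T). y \<notin> extent T b \<and>
    (\<forall>z\<in>extent S c. f z \<in> extent T b)}"
  have "lattice_filter (alg S) M"
  proof -
    have "\<one>\<^bsub>alg S\<^esub> \<in> M"
      using y le_pts by (auto simp: M_def T.extent_one S.extent_one S.one_closed
          intro: bexI[of _ "\<one>\<^bsub>alg T\<^esub>"] T.one_closed)
    moreover have "c \<sqinter>\<^bsub>alg S\<^esub> d \<in> M" if cd: "c \<in> M" "d \<in> M" for c d
    proof -
      obtain p q where "p \<in> carr (alg T)" "y \<in> extent T p" "q \<in> carr (alg T)" "y \<in> extent T q"
        "\<forall>z. ?le x z \<longrightarrow> f z \<in> extent T p \<longrightarrow> z \<in> extent S c"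
        "\<forall>z. ?le x z \<longrightarrow> f z \<in> extent T q \<longrightarrow> z \<in> extent S d"
        using cd unfolding M_def by blast
      then have "p \<sqinter>\<^bsub>alg T\<^esub> q \<in> carr (alg T) \<and> y \<in> extent T (p \<sqinter>\<^bsub>alg T\<^esub> q) \<and>
        (\<forall>z. ?le x z \<longrightarrow> f z \<in> extent T (p \<sqinter>\<^bsub>alg T\<^esub> q) \<longrightarrow> z \<in> extent S c \<inter> extent S d)"
        by (simp add: T.extent_meet T.meet_closed)
      then show ?thesis
        using cd by (auto simp: M_def S.extent_meet S.meet_closed)
    qed
    moreover have "c \<squnion>\<^bsub>alg S\<^esub> d \<in> M" if cd: "c \<in> M" "d \<in> carr (alg S)" for c d
      using cd by (auto simp: M_def S.extent_join S.join_closed)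
    ultimately show ?thesis
      by (auto simp: lattice_filter_def M_def)
  qed
  moreover have "lattice_ideal (alg S) I"
  proof -
    have "\<zero>\<^bsub>alg S\<^esub> \<in> I"
      by (auto simp: I_def T.extent_zero S.extent_zero S.zero_closed
          intro: bexI[of _ "\<zero>\<^bsub>alg T\<^esub>"] T.zero_closed)
    moreover have "c \<squnion>\<^bsub>alg S\<^esub> d \<in> I" if cd: "c \<in> I" "d \<in> I" for c d
    proof -
      obtain p q where "p \<in> carr (alg T)" "y \<notin> extent T p" "q \<in> carr (alg T)" "y \<notin> extent T q"
        "\<forall>z\<in>extent S c. f z \<in> extent T p" "\<forall>z\<in>extent S d. f z \<in> extent T q"
        using cd unfolding I_def by blast
      then have "p \<squnion>\<^bsub>alg T\<^esub> q \<in> carr (alg T) \<and> y \<notin> extent T (p \<squnion>\<^bsub>alg T\<^esub> q) \<and>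
        (\<forall>z\<in>extent S c \<union> extent S d. f z \<in> extent T (p \<squnion>\<^bsub>alg T\<^esub> q))"
        by (auto simp: T.extent_join T.join_closed)
      then show ?thesis
        using cd by (auto simp: I_def S.extent_join S.join_closed)
    qed
    moreover have "c \<sqinter>\<^bsub>alg S\<^esub> d \<in> I" if cd: "c \<in> I" "d \<in> carr (alg S)" for c d
      using cd by (auto simp: I_def S.extent_meet S.meet_closed)
    ultimately show ?thesis
      by (auto simp: lattice_ideal_def I_def)
  qed
  moreover have "M \<inter> I = {}"
  proof -
    have False if "c \<in> M" "c \<in> I" for c
    proof -
      obtain p q where p: "p \<in> carr (alg T)" "y \<in> extent T p"
          "\<forall>z. ?le x z \<longrightarrow> f z \<in> extent T p \<longrightarrow> z \<in> extent S c"
        and q: "q \<in> carr (alg T)" "y \<notin> extent T q" "\<forall>z\<in>extent S c. f z \<in> extent T q"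
        using \<open>c \<in> M\<close> \<open>c \<in> I\<close> unfolding M_def I_def by blast
      \<comment> \<open>A common element \<open>c\<close> links \<open>g p\<close> to
        \<open>g q\<close> at all points above \<open>x\<close>. Since \<open>g\<close> preserves
        implication, \<open>f x\<close> satisfies \<open>p \<leadsto> q\<close>, although
        \<open>y\<close> lies above \<open>f x\<close>, satisfies \<open>p\<close> and refutes
        \<open>q\<close>.\<close>
      have "x \<in> extent S (g p \<leadsto>\<^bsub>alg S\<^esub> g q)"
        using p q x le_pts
        by (auto simp: S.extent_himp heyting_hom_closed[OF hom] ext)
      also have "g p \<leadsto>\<^bsub>alg S\<^esub> g q = g (p \<leadsto>\<^bsub>alg T\<^esub> q)"
        using hom p(1) q(1) by (simp add: heyting_hom_def)
      finally have "f x \<in> extent T (p \<leadsto>\<^bsub>alg T\<^esub> q)"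
        using ext[OF T.himp_closed[OF p(1) q(1)]] by simp
      then show False
        using le p q by (simp add: T.extent_himp)
    qed
    then show ?thesis by blast
  qed
  ultimately show ?thesis
  proof (rule S.separating_point)
    fix z assume z: "z \<in> pts S" "\<And>c. c \<in> M \<Longrightarrow> z \<in> extent S c" "\<And>c. c \<in> I \<Longrightarrow> z \<notin> extent S c"
    have "z \<in> extent S c" if c: "c \<in> carr (alg S)" "x \<in> extent S c" for c
    \<comment> \<open>The witness for membership in \<open>M\<close> is the top element, which holds
      at \<open>y\<close>.\<close>
    proof (rule z(2))
      have "\<forall>z. ?le x z \<longrightarrow> z \<in> extent S c"
        using c by (simp add: S.ord_spectral_space_iff)
      then show "c \<in> M"
        using c y by (auto simp: M_def T.extent_one intro: bexI[of _ "\<one>\<^bsub>alg T\<^esub>"] T.one_closed)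
    qed
    then have "?le x z"
      using x z(1) by (simp add: S.ord_spectral_space_iff)
    moreover have "f z = y"
    proof (rule T.point_eqI)
      fix b assume b: "b \<in> carr (alg T)"
      have "g b \<in> M" if "y \<in> extent T b"
        using that b le_pts by (auto simp: M_def heyting_hom_closed[OF hom] ext)
      moreover have "g b \<in> I" if "y \<notin> extent T b"
        using that b by (auto simp: I_def heyting_hom_closed[OF hom] ext)
      ultimately show "f z \<in> extent T b \<longleftrightarrow> y \<in> extent T b"
        using z(1) z(2,3)[of "g b"] b by (cases "y \<in> extent T b") (auto simp: ext)
    qed (use z(1) f y in auto)
    ultimately show thesis
      by (rule that)
  qed
qed

lemma esakia_morphism_if_system_morphism:
  assumes fg: "system_morphism S T (f, g)"
  shows "esakia_morphism (spectral_space S) (spectral_space T) f"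
proof -
  have f: "f \<in> pts S \<rightarrow>\<^sub>E pts T" and hom: "heyting_hom (alg T) (alg S) g"
    and ext: "\<And>b. b \<in> carr (alg T) \<Longrightarrow> {x \<in> pts S. f x \<in> extent T b} = extent S (g b)"
    using fg by (auto simp: system_morphism_iff_extent)
  have g: "g b \<in> carr (alg S)" if "b \<in> carr (alg T)" for b
    using hom that by (rule heyting_hom_closed)
  \<comment> \<open>Preimages of both kinds of subbasic sets are again subbasic, which yields
    continuity.\<close>
  have "f -` extent T b \<inter> pts S = extent S (g b)"
      "f -` (pts T - extent T b) \<inter> pts S = pts S - extent S (g b)"
    if "b \<in> carr (alg T)" for b
    using ext[OF that] f by (auto simp: PiE_iff)
  then have "continuous_map (topo (spectral_space S)) (topo (spectral_space T)) f"
    using f g S.clopenin_extent T.one_closed unfolding spectral_space_def[of T]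
    by (auto intro!: continuous_on_generated_topo
        simp: S.topspace_spectral_space clopenin_def closedin_def T.extent_one PiE_iff)
  moreover have "(f x, f y) \<in> ord (spectral_space T)" if "(x, y) \<in> ord (spectral_space S)" for x y
    using that f g ext unfolding S.ord_spectral_space_iff T.ord_spectral_space_iff PiE_iff by blast
  ultimately show ?thesis
    unfolding esakia_morphism_def S.topspace_spectral_space T.topspace_spectral_space
    using f by (blast elim: spectral_bounded[OF fg] dest: S.ord_spectral_space_iff[THEN iffD1])
qed

lemma system_morphism_if_esakia_morphism:
  assumes f: "esakia_morphism (spectral_space S) (spectral_space T) f"
  shows "\<exists>g. system_morphism S T (f, g)"
proof -
  have fE: "f \<in> pts S \<rightarrow>\<^sub>E pts T"
    and cont: "continuous_map (topo (spectral_space S)) (topo (spectral_space T)) f"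
    and mono: "\<And>x y. (x, y) \<in> ord (spectral_space S) \<Longrightarrow> (f x, f y) \<in> ord (spectral_space T)"
    and bdd: "\<And>x y. \<lbrakk>x \<in> pts S; y \<in> pts T; (f x, y) \<in> ord (spectral_space T)\<rbrakk>
      \<Longrightarrow> \<exists>z\<in>pts S. (x, z) \<in> ord (spectral_space S) \<and> f z = y"
    using f by (simp_all add: esakia_morphism_def S.topspace_spectral_space T.topspace_spectral_space)
  let ?pre = "\<lambda>b. {x \<in> pts S. f x \<in> extent T b}"
  have "\<exists>a\<in>carr (alg S). ?pre b = extent S a" if b: "b \<in> carr (alg T)" for b
  proof (rule S.clopen_up_set_is_extent)
    show "clopenin (topo (spectral_space S)) (?pre b)"
      using T.clopenin_extent[OF b] openin_continuous_map_preimage[OF cont]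
        closedin_continuous_map_preimage[OF cont]
      by (simp add: clopenin_def S.topspace_spectral_space)
    show "up_set (spectral_space S) (?pre b)"
      using mono b by (fastforce simp: up_set_def S.topspace_spectral_space
          S.ord_spectral_space_iff T.ord_spectral_space_iff)
  qed
  then obtain g0 where g0: "\<And>b. b \<in> carr (alg T) \<Longrightarrow> g0 b \<in> carr (alg S)"
      "\<And>b. b \<in> carr (alg T) \<Longrightarrow> extent S (g0 b) = ?pre b"
    by metis
  define g where "g = restrict g0 (carr (alg T))"
  have g: "g b \<in> carr (alg S)" "extent S (g b) = ?pre b" if "b \<in> carr (alg T)" for b
    using that g0 by (simp_all add: g_def)
  \<comment> \<open>Each homomorphism law for \<open>g\<close> becomes an identity between
    preimages, to be tested on extents.\<close>
  have eqI: "a = a'" if "extent S a = extent S a'" "a \<in> carr (alg S)" "a' \<in> carr (alg S)" for a a'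
    using S.inj_on_extent that by (rule inj_onD)
  have "heyting_hom (alg T) (alg S) g"
    unfolding heyting_hom_def
  proof (intro conjI ballI)
    show "g \<in> carr (alg T) \<rightarrow>\<^sub>E carr (alg S)"
      using g0 by (auto simp: g_def)
    show "g \<zero>\<^bsub>alg T\<^esub> = \<zero>\<^bsub>alg S\<^esub>"
      by (rule eqI) (simp_all add: g T.zero_closed S.zero_closed S.extent_zero T.extent_zero)
    fix a b assume ab: "a \<in> carr (alg T)" "b \<in> carr (alg T)"
    show "g (a \<sqinter>\<^bsub>alg T\<^esub> b) = g a \<sqinter>\<^bsub>alg S\<^esub> g b"
      by (rule eqI) (use ab in \<open>auto simp: g T.meet_closed S.meet_closed S.extent_meet T.extent_meet\<close>)
    show "g (a \<squnion>\<^bsub>alg T\<^esub> b) = g a \<squnion>\<^bsub>alg S\<^esub> g b"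
      by (rule eqI) (use ab in \<open>auto simp: g T.join_closed S.join_closed S.extent_join T.extent_join\<close>)
    have "?pre (a \<leadsto>\<^bsub>alg T\<^esub> b) = extent S (g a \<leadsto>\<^bsub>alg S\<^esub> g b)"
    proof (intro set_eqI iffI)
      fix x assume "x \<in> ?pre (a \<leadsto>\<^bsub>alg T\<^esub> b)"
      then show "x \<in> extent S (g a \<leadsto>\<^bsub>alg S\<^esub> g b)"
        using ab mono by (auto simp: g T.extent_himp S.extent_himp S.ord_spectral_space_iff)
    next
      fix x assume x: "x \<in> extent S (g a \<leadsto>\<^bsub>alg S\<^esub> g b)"
      then have xS: "x \<in> pts S"
        using S.extent_subset by blast
      \<comment> \<open>Monotonicity gave the opposite inclusion. Here the bounded condition lifts
        \<open>y\<close> to a point above \<open>x\<close>, where the implication can be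
        applied.\<close>
      have "y \<in> extent T b" if le: "(f x, y) \<in> ord (spectral_space T)" and y: "y \<in> extent T a" for y
      proof -
        obtain z where "z \<in> pts S" "(x, z) \<in> ord (spectral_space S)" "f z = y"
          using bdd[OF xS _ le] y T.extent_subset by blast
        then show ?thesis
          using x ab y by (auto simp: g S.extent_himp)
      qed
      then show "x \<in> ?pre (a \<leadsto>\<^bsub>alg T\<^esub> b)"
        using xS fE ab by (auto simp: T.extent_himp)
    qed
    then show "g (a \<leadsto>\<^bsub>alg T\<^esub> b) = g a \<leadsto>\<^bsub>alg S\<^esub> g b"
      by (intro eqI) (use ab in \<open>auto simp: g T.himp_closed S.himp_closed\<close>)
  qed
  then show ?thesis
    using fE g by (auto simp: system_morphism_iff_extent)
qed

end

section \<open>The system of clopen up-sets\<close>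

definition clopen_up_sets :: "'x ordered_space \<Rightarrow> 'x set set" where
  "clopen_up_sets E = {U. clopenin (topo E) U \<and> up_set E U}"

text \<open>The Heyting implication of up-sets, written as the complement of a down-closure so that
  the Esakia condition shows it to be clopen.\<close>

definition up_set_imp :: "'x ordered_space \<Rightarrow> 'x set \<Rightarrow> 'x set \<Rightarrow> 'x set" where
  "up_set_imp E U V = topspace (topo E) - down_closure E (U - V)"

text \<open>The operations decode with \<open>inv e\<close>, act on sets, and encode the result.
  Since \<open>e\<close> is injective on all sets of points, decoding is exact.\<close>

definition clopen_up_algebra :: "('x set \<Rightarrow> 'a) \<Rightarrow> 'x ordered_space \<Rightarrow> 'a heyting" where
  "clopen_up_algebra e E =
    \<lparr>carr = e ` clopen_up_sets E,
     join = (\<lambda>a b. e (inv e a \<union> inv e b)),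
     meet = (\<lambda>a b. e (inv e a \<inter> inv e b)),
     himp = (\<lambda>a b. e (up_set_imp E (inv e a) (inv e b))),
     one = e (topspace (topo E)),
     zero = e {}\<rparr>"

definition clopen_up_system :: "('x set \<Rightarrow> 'a) \<Rightarrow> 'x ordered_space \<Rightarrow> ('x, 'a) top_system" where
  "clopen_up_system e E =
    \<lparr>pts = topspace (topo E),
     sat = {(x, a). \<exists>U\<in>clopen_up_sets E. a = e U \<and> x \<in> U},
     alg = clopen_up_algebra e E\<rparr>"

locale coded_esakia_space = esakia_space E
  for E :: "'x ordered_space" +
  fixes e :: "'x set \<Rightarrow> 'a"
  assumes inj_code: "inj e"
begin

lemma subset_topspace: "U \<in> clopen_up_sets E \<Longrightarrow> U \<subseteq> topspace (topo E)"
  by (simp add: clopen_up_sets_def up_set_def)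

lemma mem_mono: "\<lbrakk>U \<in> clopen_up_sets E; x \<in> U; (x, y) \<in> ord E\<rbrakk> \<Longrightarrow> y \<in> U"
  by (auto simp: clopen_up_sets_def up_set_def)

lemma ord_facts: "refl_on (topspace (topo E)) (ord E)" "trans (ord E)" "antisym (ord E)"
    "ord E \<subseteq> topspace (topo E) \<times> topspace (topo E)"
  using partial_order by (simp_all add: partial_order_on_def preorder_on_def)

lemma ord_iff:
  assumes "x \<in> topspace (topo E)" "y \<in> topspace (topo E)"
  shows "(x, y) \<in> ord E \<longleftrightarrow> (\<forall>U\<in>clopen_up_sets E. x \<in> U \<longrightarrow> y \<in> U)"
  using separation[OF assms] mem_mono by (auto simp: clopen_up_sets_def)

lemma clopen_up_sets_closed:
  "{} \<in> clopen_up_sets E" "topspace (topo E) \<in> clopen_up_sets E"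
  "\<lbrakk>U \<in> clopen_up_sets E; V \<in> clopen_up_sets E\<rbrakk> \<Longrightarrow> U \<inter> V \<in> clopen_up_sets E"
  "\<lbrakk>U \<in> clopen_up_sets E; V \<in> clopen_up_sets E\<rbrakk> \<Longrightarrow> U \<union> V \<in> clopen_up_sets E"
  using ord_facts(4)
  by (auto simp: clopen_up_sets_def clopenin_def up_set_def
      intro: openin_Int closedin_Int openin_Un closedin_Un)

lemma up_set_imp_iff:
  assumes "U \<in> clopen_up_sets E"
  shows "x \<in> up_set_imp E U V \<longleftrightarrow>
    x \<in> topspace (topo E) \<and> (\<forall>y. (x, y) \<in> ord E \<longrightarrow> y \<in> U \<longrightarrow> y \<in> V)"
  by (auto simp: up_set_imp_def down_closure_def)

lemma up_set_imp_closed: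
  assumes U: "U \<in> clopen_up_sets E" and V: "V \<in> clopen_up_sets E"
  shows "up_set_imp E U V \<in> clopen_up_sets E"
proof -
  have "clopenin (topo E) (down_closure E (U - V))"
    using U V by (intro clopen_down) (simp add: clopen_up_sets_def clopenin_def openin_diff closedin_diff)
  then have "clopenin (topo E) (up_set_imp E U V)"
    by (simp add: up_set_imp_def clopenin_def openin_diff closedin_diff)
  moreover have "up_set E (up_set_imp E U V)"
    using ord_facts(4) transD[OF ord_facts(2)]
    unfolding up_set_def up_set_imp_iff[OF U] by (auto simp: up_set_imp_def)
  ultimately show ?thesis
    by (simp add: clopen_up_sets_def)
qed

lemma subset_up_set_imp_iff:
  assumes "U \<in> clopen_up_sets E" "W \<in> clopen_up_sets E"
  shows "W \<subseteq> up_set_imp E U V \<longleftrightarrow> W \<inter> U \<subseteq> V"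
proof
  assume sub: "W \<subseteq> up_set_imp E U V"
  have "x \<in> V" if "x \<in> W \<inter> U" for x
    using that sub ord_facts(1) by (auto simp: up_set_imp_iff[OF assms(1)] refl_on_def subset_iff)
  then show "W \<inter> U \<subseteq> V" by blast
next
  assume sub: "W \<inter> U \<subseteq> V"
  show "W \<subseteq> up_set_imp E U V"
  proof
    fix x assume "x \<in> W"
    then show "x \<in> up_set_imp E U V"
      using sub subset_topspace[OF assms(2)] mem_mono[OF assms(2)]
      unfolding up_set_imp_iff[OF assms(1)] by blast
  qed
qed

section \<open>Coded clopen up-sets as a Heyting algebraic system\<close>

lemma clopen_up_algebra_simps:
  "carr (clopen_up_algebra e E) = e ` clopen_up_sets E"
  "e U \<squnion>\<^bsub>clopen_up_algebra e E\<^esub> e V = e (U \<union> V)"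
  "e U \<sqinter>\<^bsub>clopen_up_algebra e E\<^esub> e V = e (U \<inter> V)"
  "e U \<leadsto>\<^bsub>clopen_up_algebra e E\<^esub> e V = e (up_set_imp E U V)"
  "\<one>\<^bsub>clopen_up_algebra e E\<^esub> = e (topspace (topo E))"
  "\<zero>\<^bsub>clopen_up_algebra e E\<^esub> = e {}"
  "e U \<sqsubseteq>\<^bsub>clopen_up_algebra e E\<^esub> e V \<longleftrightarrow> U \<subseteq> V"
  by (auto simp: clopen_up_algebra_def hle_def inj_code inj_eq)

lemma heyting_algebra_clopen_up_algebra: "heyting_algebra (clopen_up_algebra e E)"
  \<comment> \<open>Carrier elements are replaced by codes \<open>e U\<close>; injectivity then
    cancels \<open>e\<close>, and each law becomes a fact about sets.\<close>
  by (rule heyting_algebra.intro; (unfold clopen_up_algebra_simps(1,5,6))?; (elim imageE)?;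
      (simp add: clopen_up_algebra_simps(2-4,7) inj_image_mem_iff[OF inj_code] inj_eq[OF inj_code]
        clopen_up_sets_closed up_set_imp_closed subset_up_set_imp_iff)?;
      (blast dest: subset_topspace)?)

lemma sat_clopen_up_system:
  "U \<in> clopen_up_sets E \<Longrightarrow> (x, e U) \<in> sat (clopen_up_system e E) \<longleftrightarrow> x \<in> U"
  using inj_code by (auto simp: clopen_up_system_def dest: injD)

lemma clopen_up_system_simps:
  "pts (clopen_up_system e E) = topspace (topo E)"
  "alg (clopen_up_system e E) = clopen_up_algebra e E"
  by (simp_all add: clopen_up_system_def)

lemma p_star_clopen_up_system:
  "U \<in> clopen_up_sets E \<Longrightarrow> p_star (clopen_up_system e E) x (e U) \<longleftrightarrow> x \<in> U"
  by (simp add: p_star_def clopen_up_system_simps clopen_up_algebra_simps sat_clopen_up_system)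

lemma Hom2_le_clopen_up_system_iff:
  assumes "x \<in> topspace (topo E)" "y \<in> topspace (topo E)"
  shows "Hom2_le (clopen_up_algebra e E) (p_star (clopen_up_system e E) x) (p_star (clopen_up_system e E) y)
    \<longleftrightarrow> (x, y) \<in> ord E"
  unfolding ord_iff[OF assms] by (auto simp: Hom2_le_def clopen_up_algebra_simps p_star_clopen_up_system)

lemma i_topological_system_clopen_up_system: "i_topological_system (clopen_up_system e E)"
proof (rule i_topological_system.intro, unfold clopen_up_system_simps)
  show "topspace (topo E) \<noteq> {}"
    by (rule nonempty)
next
  show "sat (clopen_up_system e E) \<subseteq> topspace (topo E) \<times> carr (clopen_up_algebra e E)"
    using subset_topspace by (auto simp: clopen_up_system_def clopen_up_algebra_simps)
next
  fix x a b assume x: "x \<in> topspace (topo E)"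
    and "a \<in> carr (clopen_up_algebra e E)" "b \<in> carr (clopen_up_algebra e E)"
  then obtain U V where UV: "a = e U" "b = e V" "U \<in> clopen_up_sets E" "V \<in> clopen_up_sets E"
    by (auto simp: clopen_up_algebra_simps)
  show "(x, a \<leadsto>\<^bsub>clopen_up_algebra e E\<^esub> b) \<in> sat (clopen_up_system e E) \<longleftrightarrow>
    (\<forall>y\<in>topspace (topo E). Hom2_le (clopen_up_algebra e E) (p_star (clopen_up_system e E) x)
        (p_star (clopen_up_system e E) y) \<longrightarrow>
      (y, a) \<notin> sat (clopen_up_system e E) \<or> (y, b) \<in> sat (clopen_up_system e E))"
    using x UV ord_facts(4)
    by (auto simp: clopen_up_algebra_simps sat_clopen_up_system up_set_imp_closed up_set_imp_iff
        Hom2_le_clopen_up_system_iff)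
qed (auto simp: heyting_algebra_clopen_up_algebra clopen_up_algebra_simps sat_clopen_up_system
    clopen_up_sets_closed)

text \<open>The clopen up-sets accepted by \<open>h\<close> and the complements of the rejected ones
  should have a common point. If they had none, compactness would yield an accepted set inside a
  rejected one, against monotonicity of \<open>h\<close>.\<close>

lemma point_of_Hom2:
  assumes h: "h \<in> Hom2 (clopen_up_algebra e E)"
  obtains x where "x \<in> topspace (topo E)" "\<And>U. U \<in> clopen_up_sets E \<Longrightarrow> x \<in> U \<longleftrightarrow> h (e U)"
proof -
  have h_meet: "h (e (U \<inter> V)) \<longleftrightarrow> h (e U) \<and> h (e V)"
    and h_join: "h (e (U \<union> V)) \<longleftrightarrow> h (e U) \<or> h (e V)"
    if "U \<in> clopen_up_sets E" "V \<in> clopen_up_sets E" for U V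
    using h that by (auto simp: Hom2_def clopen_up_algebra_simps)
  have h_top: "h (e (topspace (topo E)))" and h_bot: "\<not> h (e {})"
    using h by (auto simp: Hom2_def clopen_up_algebra_simps)
  \<comment> \<open>Pairs of an accepted and a rejected set form a directed index, via intersection
    in the first and union in the second component.\<close>
  let ?J = "{(U, V). U \<in> clopen_up_sets E \<and> V \<in> clopen_up_sets E \<and> h (e U) \<and> \<not> h (e V)}"
  let ?f = "\<lambda>p. (topspace (topo E) - fst p) \<union> snd p"
  have "\<exists>x\<in>topspace (topo E). \<forall>U\<in>clopen_up_sets E. x \<in> U \<longleftrightarrow> h (e U)"
  proof (rule ccontr)
    assume no_point: "\<not> ?thesis"
    have "compactin (topo E) (topspace (topo E))"
      using compact by (simp add: compact_space_def)
    then have "\<exists>p\<in>?J. topspace (topo E) \<subseteq> ?f p"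
    proof (rule compactin_directed_cover)
      have "(topspace (topo E), {}) \<in> ?J"
        using h_top h_bot by (simp add: clopen_up_sets_closed)
      then show "?J \<noteq> {}" by blast
    next
      fix p q assume "p \<in> ?J" "q \<in> ?J"
      then show "\<exists>r\<in>?J. ?f p \<union> ?f q \<subseteq> ?f r"
        by (intro bexI[of _ "(fst p \<inter> fst q, snd p \<union> snd q)"])
          (auto simp: clopen_up_sets_closed h_meet h_join)
    next
      fix x assume x: "x \<in> topspace (topo E)"
      then obtain U where U: "U \<in> clopen_up_sets E" "x \<in> U \<longleftrightarrow> \<not> h (e U)"
        using no_point by blast
      show "\<exists>p\<in>?J. x \<in> ?f p"
      proof (cases "x \<in> U")
        case True
        then show ?thesis
          using U h_top
          by (intro bexI[of _ "(topspace (topo E), U)"]) (auto simp: clopen_up_sets_closed)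
      next
        case False
        then show ?thesis
          using U x h_bot by (intro bexI[of _ "(U, {})"]) (auto simp: clopen_up_sets_closed)
      qed
    qed (auto simp: clopen_up_sets_def clopenin_def intro!: openin_Un openin_diff)
    then obtain U V where UV: "U \<in> clopen_up_sets E" "V \<in> clopen_up_sets E" "h (e U)" "\<not> h (e V)"
        and "topspace (topo E) \<subseteq> (topspace (topo E) - U) \<union> V"
      by auto
    then have "U \<inter> V = U"
      using subset_topspace by blast
    then show False
      using h_meet[OF UV(1,2)] UV(3,4) by simp
  qed
  then show thesis
    using that by blast
qed

lemma heyting_algebraic_clopen_up_system: "heyting_algebraic (clopen_up_system e E)"
  unfolding heyting_algebraic_def bij_betw_def clopen_up_system_simps
proof (intro conjI inj_onI set_eqI iffI)
  fix x y assume xy: "x \<in> topspace (topo E)" "y \<in> topspace (topo E)"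
    "p_star (clopen_up_system e E) x = p_star (clopen_up_system e E) y"
  then have "(x, y) \<in> ord E" "(y, x) \<in> ord E"
    by (simp_all flip: Hom2_le_clopen_up_system_iff) (simp_all add: Hom2_le_def)
  then show "x = y"
    using ord_facts(3) by (simp add: antisymD)
next
  fix h assume "h \<in> p_star (clopen_up_system e E) ` topspace (topo E)"
  then show "h \<in> Hom2 (clopen_up_algebra e E)"
    by (auto simp: Hom2_def clopen_up_algebra_simps p_star_clopen_up_system clopen_up_sets_closed)
       (auto simp: p_star_def clopen_up_system_simps clopen_up_algebra_simps)
next
  fix h assume h: "h \<in> Hom2 (clopen_up_algebra e E)"
  then obtain x where x: "x \<in> topspace (topo E)" "\<And>U. U \<in> clopen_up_sets E \<Longrightarrow> x \<in> U \<longleftrightarrow> h (e U)"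
    using point_of_Hom2 by blast
  have "p_star (clopen_up_system e E) x = h"
  proof (rule extensionalityI)
    show "p_star (clopen_up_system e E) x \<in> extensional (e ` clopen_up_sets E)"
      by (simp add: p_star_def clopen_up_system_simps clopen_up_algebra_simps)
    show "h \<in> extensional (e ` clopen_up_sets E)"
      using h by (auto simp: Hom2_def clopen_up_algebra_simps PiE_iff)
  qed (use x p_star_clopen_up_system in auto)
  then show "h \<in> p_star (clopen_up_system e E) ` topspace (topo E)"
    using x(1) by blast
qed

text \<open>The generated topology is coarser than the given one, yet it separates points by clopen
  sets. A compact topology has no strictly coarser Hausdorff topology, and the argument is carried
  out here directly.\<close>

lemma topology_generated_by_clopen_up_sets:
  "topology_generated_by (clopen_up_sets E \<union> (\<lambda>U. topspace (topo E) - U) ` clopen_up_sets E) = topo E"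
    (is "topology_generated_by ?B = _")
proof (rule topology_eq[THEN iffD2], intro allI iffI)
  fix W assume "openin (topology_generated_by ?B) W"
  then have W: "generate_topology_on ?B W"
    by (simp add: openin_topology_generated_by_iff)
  show "openin (topo E) W"
    by (rule generate_topology_on_coarsest[OF _ _ W]) (auto simp: clopen_up_sets_def clopenin_def)
next
  let ?G = "topology_generated_by ?B"
  fix W assume W: "openin (topo E) W"
  have top: "topspace ?G = topspace (topo E)"
    using subset_topspace clopen_up_sets_closed(2) by (auto simp: topology_generated_by_topspace)
  have opn: "openin ?G U" "openin ?G (topspace (topo E) - U)" if "U \<in> clopen_up_sets E" for U
    using that by (auto intro!: topology_generated_by_Basis)
  have nbhd: "\<exists>V. openin ?G V \<and> x \<in> V \<and> V \<subseteq> W" if x: "x \<in> W" for x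
  proof -
    have xX: "x \<in> topspace (topo E)"
      using x openin_subset[OF W] by blast
    \<comment> \<open>Openness in the given topology lets compactness apply; closedness in the
      generated one makes the complement of the chosen set a neighbourhood of \<open>x\<close>
      inside \<open>W\<close>.\<close>
    let ?J = "{C. openin (topo E) C \<and> closedin ?G C \<and> x \<notin> C}"
    have "compactin (topo E) (topspace (topo E) - W)"
      using W compact by (simp add: closedin_compact_space closedin_diff)
    then have "\<exists>C\<in>?J. topspace (topo E) - W \<subseteq> C"
    proof (rule compactin_directed_cover)
      fix y assume y: "y \<in> topspace (topo E) - W"
      \<comment> \<open>By antisymmetry distinct points are unrelated in at least one direction, and
        each direction supplies a separating clopen up-set.\<close>
      have "(x, y) \<notin> ord E \<or> (y, x) \<notin> ord E"
        using x y antisymD[OF ord_facts(3)] by blast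
      then show "\<exists>C\<in>?J. y \<in> C"
      proof
        assume "(x, y) \<notin> ord E"
        then obtain U where U: "U \<in> clopen_up_sets E" "x \<in> U" "y \<notin> U"
          using ord_iff xX y by blast
        have "closedin ?G (topspace (topo E) - U)"
          using opn(1)[OF U(1)] by (metis top openin_closedin_eq)
        then have "topspace (topo E) - U \<in> ?J"
          using U by (simp add: clopen_up_sets_def clopenin_def openin_diff)
        then show ?thesis
          using U y by blast
      next
        assume "(y, x) \<notin> ord E"
        then obtain U where U: "U \<in> clopen_up_sets E" "y \<in> U" "x \<notin> U"
          using ord_iff xX y by blast
        have "closedin ?G U"
          using opn(2)[OF U(1)] subset_topspace[OF U(1)] top by (simp only: closedin_def)
        then have "U \<in> ?J"
          using U by (simp add: clopen_up_sets_def clopenin_def)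
        then show ?thesis
          using U by blast
      qed
    next
      have "{} \<in> ?J" by simp
      then show "?J \<noteq> {}" by blast
    next
      fix C D assume "C \<in> ?J" "D \<in> ?J"
      then have "C \<union> D \<in> ?J"
        by (simp add: openin_Un closedin_Un)
      then show "\<exists>K\<in>?J. C \<union> D \<subseteq> K" by blast
    qed simp
    then obtain C where "closedin ?G C" "x \<notin> C" "topspace (topo E) - W \<subseteq> C"
      by blast
    then show ?thesis
      using xX by (intro exI[of _ "topspace (topo E) - C"])
        (auto simp only: closedin_def top)
  qed
  show "openin ?G W"
    by (rule openin_subopen[THEN iffD2]) (intro ballI nbhd)
qed

end

section \<open>The equivalence\<close>

lemma (in coded_esakia_space) spectral_space_clopen_up_system:
  "spectral_space (clopen_up_system e E) = E"
proof (rule ordered_space.equality)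
  have "extent (clopen_up_system e E) (e U) = U" if "U \<in> clopen_up_sets E" for U
    using that subset_topspace by (auto simp: extent_def sat_clopen_up_system clopen_up_system_simps)
  then show "topo (spectral_space (clopen_up_system e E)) = topo E"
    by (simp add: spectral_space_def clopen_up_system_simps clopen_up_algebra_simps image_image
        topology_generated_by_clopen_up_sets)
  show "ord (spectral_space (clopen_up_system e E)) = ord E"
    using ord_facts(4)
    by (auto simp: spectral_space_def clopen_up_system_simps Hom2_le_clopen_up_system_iff)
qed simp

text \<open>\<open>compose\<close> is restricted to the carrier of \<open>A\<close>; the order of
  \<open>A\<close> must stay inside that carrier for monotonicity to pass to the restricted
  map.\<close>

lemma esakia_morphism_compose:
  assumes f: "esakia_morphism A B f" and g: "esakia_morphism B C g"
    and A: "ord A \<subseteq> topspace (topo A) \<times> topspace (topo A)"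
  shows "esakia_morphism A C (compose (topspace (topo A)) g f)"
proof -
  have fA: "f x \<in> topspace (topo B)" if "x \<in> topspace (topo A)" for x
    using f that by (auto simp: esakia_morphism_def)
  have "continuous_map (topo A) (topo C) (g \<circ> f)"
    using f g by (auto simp: esakia_morphism_def intro: continuous_map_compose)
  then have "continuous_map (topo A) (topo C) (compose (topspace (topo A)) g f)"
    by (rule continuous_map_eq) (simp add: compose_eq)
  moreover have "(compose (topspace (topo A)) g f x, compose (topspace (topo A)) g f y) \<in> ord C"
    if "(x, y) \<in> ord A" for x y
    using that A f g by (auto simp: esakia_morphism_def compose_def)
  moreover have "\<exists>z\<in>topspace (topo A). (x, z) \<in> ord A \<and> compose (topspace (topo A)) g f z = y"
    if x: "x \<in> topspace (topo A)" and y: "y \<in> topspace (topo C)"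
      and le: "(compose (topspace (topo A)) g f x, y) \<in> ord C" for x y
  proof -
    have "(g (f x), y) \<in> ord C"
      using x le by (simp add: compose_eq)
    then obtain w where w: "w \<in> topspace (topo B)" "(f x, w) \<in> ord B" "g w = y"
      using g fA[OF x] y unfolding esakia_morphism_def by blast
    then obtain z where "z \<in> topspace (topo A)" "(x, z) \<in> ord A" "f z = w"
      using f x unfolding esakia_morphism_def by blast
    then show ?thesis
      using w by (auto simp: compose_eq)
  qed
  moreover have "compose (topspace (topo A)) g f \<in> topspace (topo A) \<rightarrow>\<^sub>E topspace (topo C)"
    using f g by (auto simp: esakia_morphism_def compose_def)
  ultimately show ?thesis
    by (simp add: esakia_morphism_def)
qed

section \<open>The category laws for both categories\<close>

lemma category_ESA: "category (ESA :: ('x ordered_space, 'x \<Rightarrow> 'x) cat)"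
proof
  fix A :: "'x ordered_space" assume "A \<in> obj ESA"
  then have ord: "ord A \<subseteq> topspace (topo A) \<times> topspace (topo A)"
    by (auto simp: ESA_def esakia_space_def partial_order_on_def preorder_on_def)
  have "continuous_map (topo A) (topo A) (\<lambda>x\<in>topspace (topo A). x)"
    by (rule continuous_map_eq[OF continuous_map_id]) simp
  then show "ide ESA A \<in> hom ESA A A"
    using ord by (auto simp: ESA_def esakia_morphism_def)
next
  fix A B C f g
  assume "A \<in> obj ESA" "f \<in> hom ESA A B" "g \<in> hom ESA B C"
  then show "cat.comp ESA A B C g f \<in> hom ESA A C"
    by (auto simp: ESA_def esakia_space_def partial_order_on_def preorder_on_def
        intro!: esakia_morphism_compose)
next
  fix A B f
  assume "f \<in> hom ESA A B"
  then have f: "f \<in> topspace (topo A) \<rightarrow>\<^sub>E topspace (topo B)"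
    by (simp add: ESA_def esakia_morphism_def)
  then have "f x \<in> topspace (topo B)" if "x \<in> topspace (topo A)" for x
    using that by blast
  then show "cat.comp ESA A A B f (ide ESA A) = f" "cat.comp ESA A B B (ide ESA B) f = f"
    using f by (auto simp: ESA_def compose_def restrict_def PiE_iff extensional_def fun_eq_iff)
next
  fix A B C D f g h
  assume "f \<in> hom ESA A B"
  then have "f \<in> topspace (topo A) \<rightarrow> topspace (topo B)"
    by (auto simp: ESA_def esakia_morphism_def)
  then show "cat.comp ESA A C D h (cat.comp ESA A B C g f) = cat.comp ESA A B D (cat.comp ESA B C D h g) f"
    by (simp add: ESA_def compose_assoc)
qed

lemma heyting_hom_compose:
  assumes f: "heyting_hom A B f" and g: "heyting_hom B C g"
    and A: "heyting_algebra A"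
  shows "heyting_hom A C (compose (carr A) g f)"
proof -
  interpret heyting_algebra A by fact
  have "f a \<in> carr B" if "a \<in> carr A" for a
    using f that by (rule heyting_hom_closed)
  then show ?thesis
    using f g by (auto simp: heyting_hom_def compose_def join_closed meet_closed himp_closed zero_closed)
qed

lemma heyting_hom_ide:
  assumes "heyting_algebra A"
  shows "heyting_hom A A (\<lambda>a\<in>carr A. a)"
proof -
  interpret heyting_algebra A by fact
  show ?thesis
    by (simp add: heyting_hom_def join_closed meet_closed himp_closed zero_closed)
qed

lemma category_HI_TopSys:
  "category (HI_TopSys :: (('x, 'a) top_system, ('x \<Rightarrow> 'x) \<times> ('a \<Rightarrow> 'a)) cat)"
proof
  fix S :: "('x, 'a) top_system" assume "S \<in> obj HI_TopSys"
  then interpret heyting_algebraic_system S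
    by (simp add: obj_HI_TopSys_iff)
  show "ide HI_TopSys S \<in> hom HI_TopSys S S"
    using heyting_hom_ide[OF heyting] extent_subset
    by (auto simp: HI_TopSys_def system_morphism_iff_extent)
next
  fix S T U :: "('x, 'a) top_system" and f g
  assume "U \<in> obj HI_TopSys" and f: "f \<in> hom HI_TopSys S T" and g: "g \<in> hom HI_TopSys T U"
  then have U: "heyting_algebra (alg U)"
    by (simp add: HI_TopSys_def i_topological_system_def)
  obtain f1 f2 g1 g2 where eq: "f = (f1, f2)" "g = (g1, g2)"
    by fastforce
  have f': "f1 \<in> pts S \<rightarrow>\<^sub>E pts T" "heyting_hom (alg T) (alg S) f2"
      "\<forall>b\<in>carr (alg T). extent S (f2 b) = {x \<in> pts S. f1 x \<in> extent T b}"
    and g': "g1 \<in> pts T \<rightarrow>\<^sub>E pts U" "heyting_hom (alg U) (alg T) g2"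
      "\<forall>b\<in>carr (alg U). extent T (g2 b) = {x \<in> pts T. g1 x \<in> extent U b}"
    using f g unfolding eq by (auto simp: HI_TopSys_def system_morphism_iff_extent)
  have "compose (pts S) g1 f1 \<in> pts S \<rightarrow>\<^sub>E pts U"
    using f'(1) g'(1) by (auto simp: compose_def)
  moreover have "extent S (compose (carr (alg U)) f2 g2 b) = {x \<in> pts S. compose (pts S) g1 f1 x \<in> extent U b}"
    if "b \<in> carr (alg U)" for b
    using that f'(1,3) g'(3) heyting_hom_closed[OF g'(2) that] by (auto simp: compose_def)
  ultimately show "cat.comp HI_TopSys S T U g f \<in> hom HI_TopSys S U"
    using heyting_hom_compose[OF g'(2) f'(2) U]
    by (simp add: eq HI_TopSys_def system_morphism_iff_extent)
next
  fix S T :: "('x, 'a) top_system" and f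
  assume "f \<in> hom HI_TopSys S T"
  then obtain f1 f2 where eq: "f = (f1, f2)" and f1: "f1 \<in> pts S \<rightarrow>\<^sub>E pts T"
    and f2: "f2 \<in> carr (alg T) \<rightarrow>\<^sub>E carr (alg S)"
    by (cases f) (auto simp: HI_TopSys_def system_morphism_iff_extent heyting_hom_def)
  have "f1 x \<in> pts T" if "x \<in> pts S" for x
    using f1 that by blast
  moreover have "f2 b \<in> carr (alg S)" if "b \<in> carr (alg T)" for b
    using f2 that by blast
  ultimately show "cat.comp HI_TopSys S S T f (ide HI_TopSys S) = f"
      "cat.comp HI_TopSys S T T (ide HI_TopSys T) f = f"
    using f1 f2
    by (auto simp: eq HI_TopSys_def compose_def restrict_def PiE_iff extensional_def fun_eq_iff)
next
  fix R S T U :: "('x, 'a) top_system" and f g h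
  assume "f \<in> hom HI_TopSys R S" and "g \<in> hom HI_TopSys S T" and "h \<in> hom HI_TopSys T U"
  moreover obtain f1 f2 g1 g2 h1 h2 where eq: "f = (f1, f2)" "g = (g1, g2)" "h = (h1, h2)"
    by (metis prod.collapse)
  ultimately have "f1 \<in> pts R \<rightarrow> pts S" "h2 \<in> carr (alg U) \<rightarrow> carr (alg T)"
    by (auto simp: HI_TopSys_def system_morphism_iff_extent heyting_hom_def)
  then show "cat.comp HI_TopSys R T U h (cat.comp HI_TopSys R S T g f) =
      cat.comp HI_TopSys R S U (cat.comp HI_TopSys S T U h g) f"
    by (simp add: eq HI_TopSys_def compose_assoc)
qed

section \<open>The forgetful functor and its full faithfulness\<close>

definition spectral_functor ::
    "(('x, 'a) top_system, ('x \<Rightarrow> 'x) \<times> ('a \<Rightarrow> 'a), 'x ordered_space, 'x \<Rightarrow> 'x) func" where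
  "spectral_functor = \<lparr>on_obj = spectral_space, on_hom = (\<lambda>S T. fst)\<rparr>"

lemma topspace_spectral_space_obj:
  "S \<in> obj HI_TopSys \<Longrightarrow> topspace (topo (spectral_space S)) = pts S"
  by (simp add: obj_HI_TopSys_iff heyting_algebraic_system.topspace_spectral_space)

lemma system_pair_obj: "\<lbrakk>S \<in> obj HI_TopSys; T \<in> obj HI_TopSys\<rbrakk> \<Longrightarrow> system_pair S T"
  by (simp add: obj_HI_TopSys_iff system_pair_def)

lemma cat_functor_spectral_functor:
  "cat_functor (HI_TopSys :: (('x, 'a) top_system, ('x \<Rightarrow> 'x) \<times> ('a \<Rightarrow> 'a)) cat) ESA
    spectral_functor"
proof
  fix S :: "('x, 'a) top_system" assume S: "S \<in> obj HI_TopSys"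
  then show "on_obj spectral_functor S \<in> obj ESA"
    by (simp add: obj_HI_TopSys_iff ESA_def spectral_functor_def
        heyting_algebraic_system.esakia_space_spectral_space)
  show "on_hom spectral_functor S S (ide HI_TopSys S) = ide ESA (on_obj spectral_functor S)"
    by (simp add: spectral_functor_def HI_TopSys_def ESA_def topspace_spectral_space_obj[OF S])
next
  fix S T :: "('x, 'a) top_system" and f
  assume "S \<in> obj HI_TopSys" "T \<in> obj HI_TopSys" "f \<in> hom HI_TopSys S T"
  then show "on_hom spectral_functor S T f \<in> hom ESA (on_obj spectral_functor S) (on_obj spectral_functor T)"
    using system_pair.esakia_morphism_if_system_morphism[OF system_pair_obj, of S T "fst f" "snd f"]
    by (simp add: spectral_functor_def HI_TopSys_def ESA_def)
next
  fix S T U :: "('x, 'a) top_system" and f g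
  assume "S \<in> obj HI_TopSys"
  then show "on_hom spectral_functor S U (cat.comp HI_TopSys S T U g f) =
      cat.comp ESA (on_obj spectral_functor S) (on_obj spectral_functor T) (on_obj spectral_functor U)
        (on_hom spectral_functor T U g) (on_hom spectral_functor S T f)"
    by (simp add: spectral_functor_def topspace_spectral_space_obj HI_TopSys_def ESA_def split_beta)
qed

lemma spectral_functor_fully_faithful:
  assumes "S \<in> obj HI_TopSys" "T \<in> obj HI_TopSys"
  shows "bij_betw (on_hom spectral_functor S T) (hom HI_TopSys S T)
    (hom ESA (on_obj spectral_functor S) (on_obj spectral_functor T))"
proof -
  interpret system_pair S T
    using assms by (rule system_pair_obj)
  have "inj_on fst {f. system_morphism S T f}"
    using system_morphism_cong_snd by (auto simp: inj_on_def)
  moreover have "fst ` {f. system_morphism S T f} =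
      {f. esakia_morphism (spectral_space S) (spectral_space T) f}"
    using esakia_morphism_if_system_morphism system_morphism_if_esakia_morphism
    by (fastforce simp: image_iff)
  ultimately show ?thesis
    by (simp add: bij_betw_def spectral_functor_def HI_TopSys_def ESA_def)
qed

theorem theorem6:
  assumes "\<exists>e :: 'x set \<Rightarrow> 'a. inj e"
  shows "equivalent_categories
    (HI_TopSys :: (('x, 'a) top_system, ('x \<Rightarrow> 'x) \<times> ('a \<Rightarrow> 'a)) cat)
    (ESA :: ('x ordered_space, 'x \<Rightarrow> 'x) cat)"
proof (rule equivalent_categories_if_fully_faithful_surj[OF category_HI_TopSys category_ESA
      cat_functor_spectral_functor spectral_functor_fully_faithful])
  fix E :: "'x ordered_space" assume E: "E \<in> obj ESA"
  \<comment> \<open>Only surjectivity on objects needs the codes: they make room in the type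
    \<open>'a\<close> for the clopen up-sets of \<open>E\<close>.\<close>
  obtain e :: "'x set \<Rightarrow> 'a" where "inj e"
    using assms by blast
  with E interpret coded_esakia_space E e
    by (simp add: ESA_def coded_esakia_space_def coded_esakia_space_axioms_def)
  have "clopen_up_system e E \<in> obj HI_TopSys"
    by (simp add: HI_TopSys_def i_topological_system_clopen_up_system heyting_algebraic_clopen_up_system)
  then show "\<exists>S\<in>obj (HI_TopSys :: (('x, 'a) top_system, ('x \<Rightarrow> 'x) \<times> ('a \<Rightarrow> 'a)) cat).
      on_obj spectral_functor S = E"
    by (rule bexI[rotated]) (simp add: spectral_functor_def spectral_space_clopen_up_system)
qed

end
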